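(* Let $(M^{4n},Q,g)$ be an almost-quaternionic Hermitian manifold of dimension $4n\geq 8$. Suppose that the fundamental $4$-form $\Omega$ of $(M,Q,g)$ is conformal-Killing. Then $(M,Q,g)$ is quaternionic-Kähler.
   Context: An almost-quaternionic structure on a manifold $M$ of dimension $4n$ is a rank-three vector sub-bundle $Q\subset \mathrm{End}(TM)$ locally generated by three anti-commuting almost complex structures $\{J_1,J_2,J_3\}$ with $J_1\circ J_2=J_3$ (such a triple is called an admissible basis of $Q$). An almost-quaternionic Hermitian structure $(Q,g)$ on $M$ consists of an almost-quaternionic structure $Q$ and a Riemannian metric $g$ such that $g(JX,JY)=g(X,Y)$ for all $J\in Q$ with $J^2=-\mathrm{Id}$ and all $X,Y\in TM$. The fundamental $4$-form of $(M,Q,g)$ is $\Omega=\omega_1\wedge\omega_1+\omega_2\wedge\omega_2+\omega_3\wedge\omega_3$, where $\omega_i:=g(J_i\cdot,\cdot)$ and $\{J_1,J_2,J_3\}$ is any local admissible basis of $Q$; it does not depend on the choice of admissible basis, hence is globally defined. A $p$-form $\psi$ ($p\ge 1$) on a Riemannian manifold $(M^m,g)$ with Levi-Civita connection $\nabla$ is conformal-Killing if $$\nabla_X\psi=\frac{1}{p+1}\,i_Xd\psi-\frac{1}{m-p+1}\,X\wedge\delta\psi\qquad\text{for all }X\in TM,$$ where tangent vectors are identified with $1$-forms by means of $g$ and $\delta\psi=-\sum_i(\nabla_{E_i}\psi)(E_i,\cdot)$ for a local orthonormal frame $\{E_i\}$. (Here $m=4n$, $p=4$.) $(M,Q,g)$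 (of dimension $4n\geq 8$) is quaternionic-Kähler if the Levi-Civita connection $\nabla$ of $g$ preserves the bundle $Q$. *)

theory Defs
  imports "HOL-Analysis.Analysis" "HOL-Combinatorics.Permutations"
begin

section \<open>Smooth manifolds\<close>

text \<open>
  A function on an open subset of a Euclidean space is of class \<open>C\<^sup>k\<^sup>+\<^sup>1\<close> iff it is differentiable
  and all its directional derivatives along constant vectors are of class \<open>C\<^sup>k\<close>.
\<close>

primrec Ck_on :: "nat \<Rightarrow> 'a::euclidean_space set \<Rightarrow> ('a \<Rightarrow> 'b::real_normed_vector) \<Rightarrow> bool" where
  "Ck_on 0 S f \<longleftrightarrow> continuous_on S f"
| "Ck_on (Suc k) S f \<longleftrightarrow>
     (\<forall>x\<in>S. f differentiable (at x)) \<and> (\<forall>v. Ck_on k S (\<lambda>x. frechet_derivative f (at x) v))"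

definition smooth_on :: "'a::euclidean_space set \<Rightarrow> ('a \<Rightarrow> 'b::real_normed_vector) \<Rightarrow> bool" where
  "smooth_on S f \<longleftrightarrow> (\<forall>k. Ck_on k S f)"

text \<open>A chart consists of its domain and its coordinate map into the model space \<open>'e\<close>.\<close>

type_synonym ('p, 'e) chart = "'p set \<times> ('p \<Rightarrow> 'e)"

abbreviation chart_dom :: "('p, 'e) chart \<Rightarrow> 'p set" where
  "chart_dom c \<equiv> fst c"

abbreviation coord :: "('p, 'e) chart \<Rightarrow> 'p \<Rightarrow> 'e" where
  "coord c \<equiv> snd c"

definition chart_image :: "('p, 'e) chart \<Rightarrow> 'e set" where
  "chart_image c = coord c ` chart_dom c"

definition transition :: "('p, 'e) chart \<Rightarrow> ('p, 'e) chart \<Rightarrow> 'e \<Rightarrow> 'e" where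
  "transition c c' = (\<lambda>x. coord c' (inv_into (chart_dom c) (coord c) x))"

definition smooth_manifold :: "'p topology \<Rightarrow> ('p, 'e::euclidean_space) chart set \<Rightarrow> bool" where
  "smooth_manifold M \<A> \<longleftrightarrow>
     Hausdorff_space M \<and> second_countable M \<and>
     (\<Union>c\<in>\<A>. chart_dom c) = topspace M \<and>
     (\<forall>c\<in>\<A>. openin M (chart_dom c) \<and> open (chart_image c) \<and>
        homeomorphic_map (subtopology M (chart_dom c)) (top_of_set (chart_image c)) (coord c)) \<and>
     (\<forall>c\<in>\<A>. \<forall>c'\<in>\<A>. smooth_on (coord c ` (chart_dom c \<inter> chart_dom c')) (transition c c'))"

text \<open>
  Tangent vectors at a point are represented by their components in a chart, which are elements of
  the model space \<open>'e\<close>. Accordingly, tensor fields are given by their local representatives in the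
  charts of the atlas (functions on the images of the charts); representatives in two charts are
  related by the differential \<open>jac c c' p\<close> of the change of coordinates.
\<close>

definition jac :: "('p, 'e::euclidean_space) chart \<Rightarrow> ('p, 'e) chart \<Rightarrow> 'p \<Rightarrow> 'e \<Rightarrow>\<^sub>L 'e" where
  "jac c c' p = Blinfun (frechet_derivative (transition c c') (at (coord c p)))"


section \<open>Riemannian metrics and almost-quaternionic Hermitian structures\<close>

type_synonym 'e bilin = "'e \<Rightarrow>\<^sub>L 'e \<Rightarrow>\<^sub>L real"

definition riemannian_metric ::
    "('p, 'e::euclidean_space) chart set \<Rightarrow> (('p, 'e) chart \<Rightarrow> 'e \<Rightarrow> 'e bilin) \<Rightarrow> bool" where
  "riemannian_metric \<A> g \<longleftrightarrow>
     (\<forall>c\<in>\<A>. smooth_on (chart_image c) (g c) \<and>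
        (\<forall>x\<in>chart_image c. (\<forall>u v. g c x u v = g c x v u) \<and> (\<forall>u. u \<noteq> 0 \<longrightarrow> g c x u u > 0))) \<and>
     (\<forall>c\<in>\<A>. \<forall>c'\<in>\<A>. \<forall>p\<in>chart_dom c \<inter> chart_dom c'. \<forall>u v.
        g c (coord c p) u v = g c' (coord c' p) (jac c c' p u) (jac c c' p v))"

text \<open>Pointwise notion: \<open>J1, J2, J3\<close> is an admissible basis of the fibre \<open>E\<close>.\<close>

definition admissible_basis ::
    "('e::euclidean_space \<Rightarrow>\<^sub>L 'e) set \<Rightarrow> ('e \<Rightarrow>\<^sub>L 'e) \<Rightarrow> ('e \<Rightarrow>\<^sub>L 'e) \<Rightarrow> ('e \<Rightarrow>\<^sub>L 'e) \<Rightarrow> bool" where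
  "admissible_basis E J1 J2 J3 \<longleftrightarrow>
     J1 o\<^sub>L J1 = - id_blinfun \<and> J2 o\<^sub>L J2 = - id_blinfun \<and> J3 o\<^sub>L J3 = - id_blinfun \<and>
     J1 o\<^sub>L J2 = - (J2 o\<^sub>L J1) \<and> J1 o\<^sub>L J3 = - (J3 o\<^sub>L J1) \<and> J2 o\<^sub>L J3 = - (J3 o\<^sub>L J2) \<and>
     J1 o\<^sub>L J2 = J3 \<and> E = span {J1, J2, J3}"

definition almost_quaternionic ::
    "('p, 'e::euclidean_space) chart set \<Rightarrow> (('p, 'e) chart \<Rightarrow> 'e \<Rightarrow> ('e \<Rightarrow>\<^sub>L 'e) set) \<Rightarrow> bool" where
  "almost_quaternionic \<A> Q \<longleftrightarrow>
     (\<forall>c\<in>\<A>. \<forall>x\<in>chart_image c. dim (Q c x) = 3 \<and>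
        (\<exists>W J1 J2 J3. open W \<and> x \<in> W \<and> W \<subseteq> chart_image c \<and>
           smooth_on W J1 \<and> smooth_on W J2 \<and> smooth_on W J3 \<and>
           (\<forall>y\<in>W. admissible_basis (Q c y) (J1 y) (J2 y) (J3 y)))) \<and>
     (\<forall>c\<in>\<A>. \<forall>c'\<in>\<A>. \<forall>p\<in>chart_dom c \<inter> chart_dom c'.
        Q c' (coord c' p) = (\<lambda>J. jac c c' p o\<^sub>L J o\<^sub>L jac c' c p) ` Q c (coord c p))"

definition almost_quaternionic_hermitian ::
    "('p, 'e::euclidean_space) chart set \<Rightarrow> (('p, 'e) chart \<Rightarrow> 'e \<Rightarrow> ('e \<Rightarrow>\<^sub>L 'e) set)
       \<Rightarrow> (('p, 'e) chart \<Rightarrow> 'e \<Rightarrow> 'e bilin) \<Rightarrow> bool" where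
  "almost_quaternionic_hermitian \<A> Q g \<longleftrightarrow>
     almost_quaternionic \<A> Q \<and> riemannian_metric \<A> g \<and>
     (\<forall>c\<in>\<A>. \<forall>x\<in>chart_image c. \<forall>J\<in>Q c x. J o\<^sub>L J = - id_blinfun \<longrightarrow>
        (\<forall>u v. g c x (J u) (J v) = g c x u v))"


section \<open>The Levi-Civita connection\<close>

text \<open>
  In a chart, a connection is the derivative in the model space plus a correction term
  \<open>\<Gamma>\<close> (its Christoffel symbols): \<open>\<nabla>\<^sub>u V = D\<^sub>u V + \<Gamma> u V\<close>. The Levi-Civita connection is the unique one
  which is torsion-free (\<open>\<Gamma>\<close> is symmetric) and metric, here expressed on constant fields \<open>u, v\<close>.
  Existence and uniqueness of \<open>\<Gamma>\<close> are shown in \<open>is_levi_civita_levi_civita\<close> below.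
\<close>

definition is_levi_civita ::
    "('e::euclidean_space \<Rightarrow> 'e bilin) \<Rightarrow> 'e \<Rightarrow> ('e \<Rightarrow>\<^sub>L 'e \<Rightarrow>\<^sub>L 'e) \<Rightarrow> bool" where
  "is_levi_civita G x \<Gamma> \<longleftrightarrow>
     (\<forall>u v. \<Gamma> u v = \<Gamma> v u) \<and>
     (\<forall>z u v. frechet_derivative (\<lambda>y. G y u v) (at x) z = G x (\<Gamma> z u) v + G x u (\<Gamma> z v))"

definition levi_civita ::
    "('e::euclidean_space \<Rightarrow> 'e bilin) \<Rightarrow> 'e \<Rightarrow> 'e \<Rightarrow>\<^sub>L 'e \<Rightarrow>\<^sub>L 'e" where
  "levi_civita G x = (THE \<Gamma>. is_levi_civita G x \<Gamma>)"

text \<open>Covariant derivative \<open>(\<nabla>\<^sub>u A) w\<close> of a field \<open>A\<close> of endomorphisms.\<close>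

definition cov_deriv_endo ::
    "('e::euclidean_space \<Rightarrow> 'e bilin) \<Rightarrow> ('e \<Rightarrow> 'e \<Rightarrow>\<^sub>L 'e) \<Rightarrow> 'e \<Rightarrow> 'e \<Rightarrow> 'e \<Rightarrow>\<^sub>L 'e" where
  "cov_deriv_endo G A x u =
     frechet_derivative A (at x) u + (levi_civita G x u o\<^sub>L A x) - (A x o\<^sub>L levi_civita G x u)"

text \<open>
  The values of a \<open>p\<close>-form at a point are given on lists of \<open>p\<close> tangent vectors; values on lists of
  other lengths are irrelevant.
\<close>

type_synonym 'e form = "'e list \<Rightarrow> real"

definition cov_deriv_form ::
    "('e::euclidean_space \<Rightarrow> 'e bilin) \<Rightarrow> ('e \<Rightarrow> 'e form) \<Rightarrow> 'e \<Rightarrow> 'e \<Rightarrow> 'e form" where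
  "cov_deriv_form G \<psi> x u = (\<lambda>vs.
     frechet_derivative (\<lambda>y. \<psi> y vs) (at x) u -
     (\<Sum>i<length vs. \<psi> x (vs[i := levi_civita G x u (vs ! i)])))"


section \<open>Exterior calculus and conformal-Killing forms\<close>

text \<open>
  The wedge product of a \<open>p\<close>-form and a \<open>q\<close>-form, normalised so that
  \<open>(\<alpha> \<and> \<beta>)(u, v) = \<alpha>(u) \<beta>(v) - \<alpha>(v) \<beta>(u)\<close> for 1-forms.
\<close>

definition wedge :: "nat \<Rightarrow> nat \<Rightarrow> 'e form \<Rightarrow> 'e form \<Rightarrow> 'e form" where
  "wedge p q \<alpha> \<beta> = (\<lambda>vs.
     (\<Sum>\<sigma> | \<sigma> permutes {..<p + q}. of_int (sign \<sigma>) *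
        \<alpha> (map (\<lambda>i. vs ! \<sigma> i) [0..<p]) * \<beta> (map (\<lambda>i. vs ! \<sigma> i) [p..<p + q])) / (fact p * fact q))"

definition interior_prod :: "'e \<Rightarrow> 'e form \<Rightarrow> 'e form" where
  "interior_prod u \<psi> = (\<lambda>vs. \<psi> (u # vs))"

definition ext_deriv :: "('e::euclidean_space \<Rightarrow> 'e form) \<Rightarrow> 'e \<Rightarrow> 'e form" where
  "ext_deriv \<psi> x = (\<lambda>vs. \<Sum>i<length vs. (- 1) ^ i *
     frechet_derivative (\<lambda>y. \<psi> y (take i vs @ drop (Suc i) vs)) (at x) (vs ! i))"

text \<open>The 1-form identified with a tangent vector by means of the metric.\<close>

definition flat :: "'e bilin \<Rightarrow> 'e::euclidean_space \<Rightarrow> 'e form" where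
  "flat G u = (\<lambda>vs. G u (vs ! 0))"

definition orthonormal_basis :: "'e::euclidean_space bilin \<Rightarrow> 'e set \<Rightarrow> bool" where
  "orthonormal_basis G B \<longleftrightarrow>
     finite B \<and> span B = UNIV \<and> (\<forall>a\<in>B. \<forall>b\<in>B. G a b = (if a = b then 1 else 0))"

text \<open>
  The codifferential involves \<open>\<nabla>\<psi>\<close> only at the point \<open>x\<close>, so that an orthonormal basis at \<open>x\<close> is
  enough; the choice is immaterial.
\<close>

definition codiff ::
    "('e::euclidean_space \<Rightarrow> 'e bilin) \<Rightarrow> ('e \<Rightarrow> 'e form) \<Rightarrow> 'e \<Rightarrow> 'e form" where
  "codiff G \<psi> x = (\<lambda>vs.
     - (\<Sum>e\<in>(SOME B. orthonormal_basis (G x) B). cov_deriv_form G \<psi> x e (e # vs)))"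

definition conformal_killing ::
    "('p, 'e::euclidean_space) chart set \<Rightarrow> (('p, 'e) chart \<Rightarrow> 'e \<Rightarrow> 'e bilin)
       \<Rightarrow> nat \<Rightarrow> (('p, 'e) chart \<Rightarrow> 'e \<Rightarrow> 'e form) \<Rightarrow> bool" where
  "conformal_killing \<A> g p \<psi> \<longleftrightarrow>
     (\<forall>c\<in>\<A>. \<forall>x\<in>chart_image c. \<forall>u vs. length vs = p \<longrightarrow>
        cov_deriv_form (g c) (\<psi> c) x u vs =
          1 / (real p + 1) * interior_prod u (ext_deriv (\<psi> c) x) vs -
          1 / (real DIM('e) - real p + 1) *
            wedge 1 (p - 1) (flat (g c x) u) (codiff (g c) (\<psi> c) x) vs)"


section \<open>The fundamental form and quaternionic-Kaehler manifolds\<close>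

definition kaehler_form :: "'e::euclidean_space bilin \<Rightarrow> ('e \<Rightarrow>\<^sub>L 'e) \<Rightarrow> 'e form" where
  "kaehler_form G J = (\<lambda>vs. G (J (vs ! 0)) (vs ! 1))"

definition four_form ::
    "'e::euclidean_space bilin \<Rightarrow> ('e \<Rightarrow>\<^sub>L 'e) \<Rightarrow> ('e \<Rightarrow>\<^sub>L 'e) \<Rightarrow> ('e \<Rightarrow>\<^sub>L 'e) \<Rightarrow> 'e form" where
  "four_form G J1 J2 J3 = (\<lambda>vs. \<Sum>J\<leftarrow>[J1, J2, J3]. wedge 2 2 (kaehler_form G J) (kaehler_form G J) vs)"

text \<open>
  At each point, any admissible basis of the fibre of \<open>Q\<close> may be used; see
  \<open>fundamental_form_eq\<close> below for the independence of the choice.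
\<close>

definition fundamental_form ::
    "(('p, 'e::euclidean_space) chart \<Rightarrow> 'e \<Rightarrow> ('e \<Rightarrow>\<^sub>L 'e) set) \<Rightarrow> (('p, 'e) chart \<Rightarrow> 'e \<Rightarrow> 'e bilin)
       \<Rightarrow> ('p, 'e) chart \<Rightarrow> 'e \<Rightarrow> 'e form" where
  "fundamental_form Q g c x =
     (case SOME (J1, J2, J3). admissible_basis (Q c x) J1 J2 J3 of
        (J1, J2, J3) \<Rightarrow> four_form (g c x) J1 J2 J3)"

text \<open>\<open>\<nabla>\<close> preserves \<open>Q\<close>: covariant derivatives of local smooth sections of \<open>Q\<close> take values in \<open>Q\<close>.\<close>

definition quaternionic_kaehler ::
    "('p, 'e::euclidean_space) chart set \<Rightarrow> (('p, 'e) chart \<Rightarrow> 'e \<Rightarrow> ('e \<Rightarrow>\<^sub>L 'e) set)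
       \<Rightarrow> (('p, 'e) chart \<Rightarrow> 'e \<Rightarrow> 'e bilin) \<Rightarrow> bool" where
  "quaternionic_kaehler \<A> Q g \<longleftrightarrow>
     almost_quaternionic_hermitian \<A> Q g \<and> DIM('e) \<ge> 8 \<and>
     (\<forall>c\<in>\<A>. \<forall>W A. open W \<and> W \<subseteq> chart_image c \<and> smooth_on W A \<and> (\<forall>y\<in>W. A y \<in> Q c y) \<longrightarrow>
        (\<forall>x\<in>W. \<forall>u. cov_deriv_endo (g c) A x u \<in> Q c x))"


section \<open>Well-definedness\<close>

lemma span3D:
  assumes "K \<in> span {J1, J2, J3 :: 'a::real_vector}"
  obtains a b c :: real where "K = a *\<^sub>R J1 + b *\<^sub>R J2 + c *\<^sub>R J3"
proof -
  obtain a where "K - a *\<^sub>R J1 \<in> span {J2, J3}"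
    using assms span_breakdown_eq by blast
  then obtain b where "K - a *\<^sub>R J1 - b *\<^sub>R J2 \<in> span {J3}"
    using span_breakdown_eq by blast
  then obtain c where "K - a *\<^sub>R J1 - b *\<^sub>R J2 - c *\<^sub>R J3 \<in> span {}"
    using span_breakdown_eq by blast
  then show ?thesis
    using that[of a b c] by (simp add: algebra_simps)
qed

lemma admissible_combination_compose:
  assumes "admissible_basis E J1 J2 (J3 :: 'e::euclidean_space \<Rightarrow>\<^sub>L 'e)"
    and K: "K = a *\<^sub>R J1 + b *\<^sub>R J2 + c *\<^sub>R J3" and L: "L = d *\<^sub>R J1 + e *\<^sub>R J2 + f *\<^sub>R J3"
  shows "(K o\<^sub>L L) + (L o\<^sub>L K) = - (a * d + b * e + c * f + (a * d + b * e + c * f)) *\<^sub>R id_blinfun"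
proof (rule blinfun_eqI)
  fix u :: 'e
  have *: "J1 (J1 w) = - w" "J2 (J2 w) = - w" "J3 (J3 w) = - w"
    "J2 (J1 w) = - J1 (J2 w)" "J3 (J1 w) = - J1 (J3 w)" "J3 (J2 w) = - J2 (J3 w)" for w
    using assms(1) unfolding admissible_basis_def
    by (metis (no_types, lifting) blinfun_apply_blinfun_compose blinfun_apply_id_blinfun
        minus_blinfun.rep_eq uminus_blinfun.rep_eq minus_equation_iff)+
  have two: "(p * (q * 2)) *\<^sub>R w = (p * q) *\<^sub>R w + (p * q) *\<^sub>R w" for p q :: real and w :: 'e
    by (simp flip: scaleR_left_distrib)
  show "((K o\<^sub>L L) + (L o\<^sub>L K)) u = (- (a * d + b * e + c * f + (a * d + b * e + c * f)) *\<^sub>R id_blinfun) u"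
    unfolding K L
    by (simp add: blinfun.add_left blinfun.add_right blinfun.scaleR_left blinfun.scaleR_right *)
      (simp add: algebra_simps two)
qed

lemma id_blinfun_scale_eq:
  "r *\<^sub>R (id_blinfun :: 'e::euclidean_space \<Rightarrow>\<^sub>L 'e) = s *\<^sub>R id_blinfun \<longleftrightarrow> r = s"
proof -
  have "(id_blinfun :: 'e \<Rightarrow>\<^sub>L 'e) \<noteq> 0"
    by (metis norm_blinfun_id norm_zero zero_neq_one)
  then show ?thesis by simp
qed

lemma orthonormal_rows_columns:
  fixes a1 a2 a3 b1 b2 b3 c1 c2 c3 :: real
  assumes "a1*a1 + a2*a2 + a3*a3 = 1" "b1*b1 + b2*b2 + b3*b3 = 1" "c1*c1 + c2*c2 + c3*c3 = 1"
    "a1*b1 + a2*b2 + a3*b3 = 0" "a1*c1 + a2*c2 + a3*c3 = 0" "b1*c1 + b2*c2 + b3*c3 = 0"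
  shows "a1*a1 + b1*b1 + c1*c1 = 1" "a2*a2 + b2*b2 + c2*c2 = 1" "a3*a3 + b3*b3 + c3*c3 = 1"
    "a1*a2 + b1*b2 + c1*c2 = 0" "a1*a3 + b1*b3 + c1*c3 = 0" "a2*a3 + b2*b3 + c2*c3 = 0"
proof -
  define A :: "real^3^3" where "A = vector [vector [a1, a2, a3], vector [b1, b2, b3], vector [c1, c2, c3]]"
  have "A ** transpose A = mat 1"
    using assms by (simp add: A_def vec_eq_iff forall_3 matrix_matrix_mult_def transpose_def mat_def sum_3 algebra_simps)
  then have "transpose A ** A = mat 1"
    using matrix_left_right_inverse by blast
  then have *: "(\<Sum>k\<in>UNIV. A $ k $ i * A $ k $ j) = (if i = j then 1 else 0)" for i j
    by (simp add: vec_eq_iff matrix_matrix_mult_def transpose_def mat_def)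
  show "a1*a1 + b1*b1 + c1*c1 = 1" "a2*a2 + b2*b2 + c2*c2 = 1" "a3*a3 + b3*b3 + c3*c3 = 1"
    "a1*a2 + b1*b2 + c1*c2 = 0" "a1*a3 + b1*b3 + c1*c3 = 0" "a2*a3 + b2*b3 + c2*c3 = 0"
    using *[of 1 1] *[of 2 2] *[of 3 3] *[of 1 2] *[of 1 3] *[of 2 3]
    by (simp_all add: A_def sum_3)
qed

lemma four_form_eq:
  assumes J: "admissible_basis E J1 J2 J3" and K: "admissible_basis E K1 K2 K3"
  shows "four_form G J1 J2 J3 = four_form G K1 K2 K3"
proof -
  have "K1 \<in> span {J1, J2, J3}" "K2 \<in> span {J1, J2, J3}" "K3 \<in> span {J1, J2, J3}"
    using J K unfolding admissible_basis_def by (metis insertI1 insertI2 span_base)+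
  then obtain a1 a2 a3 b1 b2 b3 c1 c2 c3 where
    K1: "K1 = a1 *\<^sub>R J1 + a2 *\<^sub>R J2 + a3 *\<^sub>R J3" and
    K2: "K2 = b1 *\<^sub>R J1 + b2 *\<^sub>R J2 + b3 *\<^sub>R J3" and
    K3: "K3 = c1 *\<^sub>R J1 + c2 *\<^sub>R J2 + c3 *\<^sub>R J3"
    by (metis span3D)
  note comp = admissible_combination_compose[OF J]
  have scale: "x + x = y *\<^sub>R z \<Longrightarrow> x = - z \<Longrightarrow> y *\<^sub>R z = (-2) *\<^sub>R z" for x z :: "'a \<Rightarrow>\<^sub>L 'a" and y :: real
    by (metis minus_add_distrib scaleR_2 scaleR_minus_left scaleR_minus_right)
  have sq: "K1 o\<^sub>L K1 = - id_blinfun" "K2 o\<^sub>L K2 = - id_blinfun" "K3 o\<^sub>L K3 = - id_blinfun"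
    and anti: "(K1 o\<^sub>L K2) + (K2 o\<^sub>L K1) = 0" "(K1 o\<^sub>L K3) + (K3 o\<^sub>L K1) = 0" "(K2 o\<^sub>L K3) + (K3 o\<^sub>L K2) = 0"
    using K unfolding admissible_basis_def by (metis add.left_inverse)+
  have zero: "r = 0" if "0 = r *\<^sub>R (id_blinfun :: 'a \<Rightarrow>\<^sub>L 'a)" for r
    using that id_blinfun_scale_eq[of r 0] by (metis scaleR_zero_left)
  have rows:
    "a1*a1 + a2*a2 + a3*a3 = 1" "b1*b1 + b2*b2 + b3*b3 = 1" "c1*c1 + c2*c2 + c3*c3 = 1"
    using scale[OF comp[OF K1 K1] sq(1)] scale[OF comp[OF K2 K2] sq(2)]
      scale[OF comp[OF K3 K3] sq(3)]
    unfolding id_blinfun_scale_eq by simp_all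
  moreover have
    "a1*b1 + a2*b2 + a3*b3 = 0" "a1*c1 + a2*c2 + a3*c3 = 0" "b1*c1 + b2*c2 + b3*c3 = 0"
    using zero[OF comp[OF K1 K2, unfolded anti]] zero[OF comp[OF K1 K3, unfolded anti]]
      zero[OF comp[OF K2 K3, unfolded anti]] by linarith+
  ultimately have cols:
    "a1*a1 + b1*b1 + c1*c1 = 1" "a2*a2 + b2*b2 + c2*c2 = 1" "a3*a3 + b3*b3 + c3*c3 = 1"
    "a1*a2 + b1*b2 + c1*c2 = 0" "a1*a3 + b1*b3 + c1*c3 = 0" "a2*a3 + b2*b3 + c2*c3 = 0"
    by (rule orthonormal_rows_columns)+
  have lin: "kaehler_form G (a *\<^sub>R J1 + b *\<^sub>R J2 + c *\<^sub>R J3) xs =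
      a * kaehler_form G J1 xs + b * kaehler_form G J2 xs + c * kaehler_form G J3 xs" for a b c xs
    by (simp add: kaehler_form_def blinfun.bilinear_simps)
  have quad: "(a1*x1+a2*x2+a3*x3)*(a1*y1+a2*y2+a3*y3) + (b1*x1+b2*x2+b3*x3)*(b1*y1+b2*y2+b3*y3)
     + (c1*x1+c2*x2+c3*x3)*(c1*y1+c2*y2+c3*y3) = x1*y1+x2*y2+x3*y3" for x1 x2 x3 y1 y2 y3
  proof -
    have "(a1*x1+a2*x2+a3*x3)*(a1*y1+a2*y2+a3*y3) + (b1*x1+b2*x2+b3*x3)*(b1*y1+b2*y2+b3*y3)
     + (c1*x1+c2*x2+c3*x3)*(c1*y1+c2*y2+c3*y3) =
      (a1*a1 + b1*b1 + c1*c1)*(x1*y1) + (a2*a2 + b2*b2 + c2*c2)*(x2*y2) + (a3*a3 + b3*b3 + c3*c3)*(x3*y3)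
      + (a1*a2 + b1*b2 + c1*c2)*(x1*y2+x2*y1) + (a1*a3 + b1*b3 + c1*c3)*(x1*y3+x3*y1)
      + (a2*a3 + b2*b3 + c2*c3)*(x2*y3+x3*y2)"
      by (simp add: algebra_simps)
    then show ?thesis unfolding cols by simp
  qed
  have key: "kaehler_form G K1 xs * kaehler_form G K1 ys + kaehler_form G K2 xs * kaehler_form G K2 ys
      + kaehler_form G K3 xs * kaehler_form G K3 ys =
      kaehler_form G J1 xs * kaehler_form G J1 ys + kaehler_form G J2 xs * kaehler_form G J2 ys
      + kaehler_form G J3 xs * kaehler_form G J3 ys" for xs ys
    unfolding K1 K2 K3 lin quad ..
  have sum3: "four_form G L1 L2 L3 vs =
     (\<Sum>\<sigma> | \<sigma> permutes {..<2 + 2}. of_int (sign \<sigma>) * (let xs = map (\<lambda>i. vs ! \<sigma> i) [0..<2];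
        ys = map (\<lambda>i. vs ! \<sigma> i) [2..<2+2] in
       kaehler_form G L1 xs * kaehler_form G L1 ys + kaehler_form G L2 xs * kaehler_form G L2 ys
      + kaehler_form G L3 xs * kaehler_form G L3 ys)) / (fact 2 * fact 2)" for L1 L2 L3 vs
    by (simp add: four_form_def wedge_def Let_def distrib_left sum.distrib add_divide_distrib mult.assoc)
  show ?thesis
    unfolding sum3[abs_def] fun_eq_iff sum3 Let_def key by simp
qed

lemma fundamental_form_eq:
  assumes "admissible_basis (Q c x) J1 J2 J3"
  shows "fundamental_form Q g c x = four_form (g c x) J1 J2 J3"
proof -
  have "case SOME (J1, J2, J3). admissible_basis (Q c x) J1 J2 J3 of
      (K1, K2, K3) \<Rightarrow> admissible_basis (Q c x) K1 K2 K3"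
    using someI[of "\<lambda>(J1, J2, J3). admissible_basis (Q c x) J1 J2 J3" "(J1, J2, J3)"] assms by simp
  then show ?thesis
    unfolding fundamental_form_def using four_form_eq[OF assms] by (auto split: prod.splits)
qed

text \<open>Existence and uniqueness of the Levi-Civita connection at a point.\<close>

lemma is_levi_civita_unique:
  fixes G :: "'e::euclidean_space \<Rightarrow> 'e bilin"
  assumes sym: "\<And>u v. G x u v = G x v u" and pos: "\<And>u. u \<noteq> 0 \<Longrightarrow> G x u u > 0"
    and \<Gamma>: "is_levi_civita G x \<Gamma>" and \<Delta>: "is_levi_civita G x \<Delta>"
  shows "\<Gamma> = \<Delta>"
proof -
  define T where "T u v = \<Gamma> u v - \<Delta> u v" for u v
  have symT: "T u v = T v u" for u v
    using \<Gamma> \<Delta> unfolding is_levi_civita_def T_def by metis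
  have skew: "G x (T z u) v + G x (T z v) u = 0" for z u v
  proof -
    have "G x (\<Gamma> z u) v + G x u (\<Gamma> z v) = G x (\<Delta> z u) v + G x u (\<Delta> z v)"
      using \<Gamma> \<Delta> unfolding is_levi_civita_def by metis
    then show ?thesis unfolding T_def using sym by (simp add: blinfun.bilinear_simps)
  qed
  have "G x (T u v) w = 0" for u v w
  proof -
    have "G x (T u v) w = - G x (T u w) v" using skew[of u v w] by simp
    also have "\<dots> = G x (T w v) u" using skew[of w u v] symT[of u w] by simp
    also have "\<dots> = - G x (T u v) w" using skew[of v w u] symT[of v w] symT[of v u] by simp
    finally show ?thesis by simp
  qed
  then have "T u v = 0" for u v using pos[of "T u v"] by force
  then show ?thesis unfolding T_def by (intro blinfun_eqI) simp
qed

lemma is_levi_civita_exists: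
  fixes G :: "'e::euclidean_space \<Rightarrow> 'e bilin"
  assumes S: "open S" "x \<in> S" and sym: "\<And>y u v. y \<in> S \<Longrightarrow> G y u v = G y v u"
    and pos: "\<And>u. u \<noteq> 0 \<Longrightarrow> G x u u > 0"
    and diff: "G differentiable (at x)"
  shows "\<exists>\<Gamma>. is_levi_civita G x \<Gamma>"
proof -
  obtain G' where G': "(G has_derivative G') (at x)"
    using diff unfolding differentiable_def by blast
  then have blG': "bounded_linear G'" by (rule has_derivative_bounded_linear)
  have D: "((\<lambda>y. G y u v) has_derivative (\<lambda>z. G' z u v)) (at x)" for u v
    by (auto intro!: derivative_eq_intros G' ext simp: blinfun.bilinear_simps)
  have fd: "frechet_derivative (\<lambda>y. G y u v) (at x) = (\<lambda>z. G' z u v)" for u v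
    using frechet_derivative_at[OF D] by metis
  have symG': "G' z u v = G' z v u" for z u v
  proof -
    have "((\<lambda>y. G y v u) has_derivative (\<lambda>z. G' z u v)) (at x)"
      using has_derivative_transform_within_open[OF D[of u v] S, of "\<lambda>y. G y v u"] sym by blast
    then show ?thesis using D[of v u] has_derivative_unique by metis
  qed
  define R where "R w = (\<Sum>b\<in>Basis. G x w b *\<^sub>R b)" for w
  have R: "R w \<bullet> z = G x w z" for w z
  proof -
    have "G x w z = G x w (\<Sum>b\<in>Basis. (z \<bullet> b) *\<^sub>R b)" by (simp add: euclidean_representation)
    also have "\<dots> = R w \<bullet> z"
      unfolding R_def
      by (simp add: blinfun.sum_right blinfun.scaleR_right inner_sum_left)
        (simp add: inner_commute mult.commute)
    finally show ?thesis by simp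
  qed
  have linR: "linear R"
    by (rule linearI) (simp_all add: R_def blinfun.bilinear_simps scaleR_left_distrib sum.distrib
        scaleR_sum_right)
  have injR: "inj R"
    unfolding linear_injective_0[OF linR] using R pos by (metis inner_zero_left order_less_irrefl)
  obtain R' where R': "linear R'" "R \<circ> R' = id"
    using linear_surjective_right_inverse[OF linR linear_injective_imp_surjective[OF linR injR]] by auto
  have RR': "R (R' w) = w" for w using R'(2) by (metis comp_apply id_apply)
  define L where "L u v = (\<Sum>b\<in>Basis. ((G' u v b + G' v u b - G' b u v) / 2) *\<^sub>R b)" for u v
  have G'lin: "G' (u + v) = G' u + G' v" "G' (r *\<^sub>R u) = r *\<^sub>R G' u" for r u v
    using blG' by (simp_all add: linear_simps)
  have L: "L u v \<bullet> z = (G' u v z + G' v u z - G' z u v) / 2" for u v z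
  proof -
    define h where "h z = (G' u v z + G' v u z - G' z u v) / 2" for z
    have h: "linear h"
      by (rule linearI) (simp_all add: h_def blinfun.bilinear_simps G'lin field_simps)
    have "h z = h (\<Sum>b\<in>Basis. (z \<bullet> b) *\<^sub>R b)" by (simp add: euclidean_representation)
    also have "\<dots> = L u v \<bullet> z"
      unfolding L_def h_def[symmetric]
      by (simp add: linear_sum[OF h] linear_scale[OF h] inner_sum_left)
        (simp add: inner_commute mult.commute)
    finally show ?thesis by (simp add: h_def)
  qed
  have blL: "bilinear (\<lambda>u v. R' (L u v))"
  proof -
    have "L (u + u') v = L u v + L u' v" "L (r *\<^sub>R u) v = r *\<^sub>R L u v"
      "L u (v + v') = L u v + L u v'" "L u (r *\<^sub>R v) = r *\<^sub>R L u v" for u u' v v' r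
      by (rule euclidean_eqI, simp add: L inner_left_distrib blinfun.bilinear_simps G'lin field_simps)+
    then have "bilinear L"
      unfolding bilinear_def by (auto intro!: linearI)
    then show ?thesis
      using R'(1) unfolding bilinear_def by (auto intro: linear_compose[unfolded o_def])
  qed
  then have bb: "bounded_bilinear (\<lambda>u v. R' (L u v))"
    by (simp add: bilinear_conv_bounded_bilinear)
  define B where "B u = Blinfun (\<lambda>v. R' (L u v))" for u
  have B: "B u v = R' (L u v)" for u v
    using bounded_linear_Blinfun_apply[OF bounded_bilinear.bounded_linear_right[OF bb]]
    unfolding B_def by metis
  have "linear B"
    by (intro linearI blinfun_eqI)
      (simp_all add: B blinfun.add_left blinfun.scaleR_left bilinear_ladd[OF blL] bilinear_lmul[OF blL])
  then have "bounded_linear B"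
    by (rule linear_conv_bounded_linear[THEN iffD1])
  then have \<Gamma>: "Blinfun B u v = R' (L u v)" for u v
    by (simp add: bounded_linear_Blinfun_apply B)
  define \<Gamma> where "\<Gamma> = Blinfun B"
  note \<Gamma> = \<Gamma>[folded \<Gamma>_def]
  have G\<Gamma>: "G x (\<Gamma> u v) z = (G' u v z + G' v u z - G' z u v) / 2" for u v z
    unfolding \<Gamma> R[symmetric] RR' L ..
  have "is_levi_civita G x \<Gamma>"
    unfolding is_levi_civita_def fd
  proof (intro conjI allI)
    show "\<Gamma> u v = \<Gamma> v u" for u v
      unfolding \<Gamma> L_def using symG' by (simp add: add.commute)
    show "G' z u v = G x (\<Gamma> z u) v + G x u (\<Gamma> z v)" for z u v
      unfolding sym[OF S(2), of u "\<Gamma> z v"] G\<Gamma>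
      using symG'[of u z v] symG'[of v z u] symG'[of z u v] by (simp add: field_simps)
  qed
  then show ?thesis ..
qed

text \<open>In particular \<open>levi_civita\<close> is well-defined for Riemannian metrics.\<close>

lemma is_levi_civita_levi_civita:
  assumes g: "riemannian_metric \<A> g" and c: "c \<in> \<A>" "open (chart_image c)" "x \<in> chart_image c"
  shows "is_levi_civita (g c) x (levi_civita (g c) x)"
proof -
  have "smooth_on (chart_image c) (g c)"
    and *: "\<And>y u v. y \<in> chart_image c \<Longrightarrow> g c y u v = g c y v u"
      "\<And>u. u \<noteq> 0 \<Longrightarrow> g c x u u > 0"
    using g c unfolding riemannian_metric_def by blast+
  then have "Ck_on (Suc 0) (chart_image c) (g c)"
    unfolding smooth_on_def by blast
  then have "g c differentiable (at x)" using c by simp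
  then have "\<exists>!\<Gamma>. is_levi_civita (g c) x \<Gamma>"
    using is_levi_civita_exists[OF c(2,3), of "g c"] is_levi_civita_unique[of "g c" x] * c(3) by blast
  then show ?thesis unfolding levi_civita_def by (rule theI')
qed

end

theory Submission
  imports Defs
begin

text \<open>
  The argument is pointwise. The covariant derivatives of an admissible basis can be written as
  \<open>\<nabla>\<^sub>u J\<^sub>1 = J\<^sub>2 S\<^sub>3 - J\<^sub>3 S\<^sub>2\<close> and cyclically, where the \<open>S\<^sub>i = S\<^sub>i(u)\<close> are symmetric and commute with all
  \<open>J\<^sub>j\<close>, and \<open>\<nabla>\<close> preserves \<open>Q\<close> as soon as all \<open>S\<^sub>i\<close> are multiples of the identity. The conformal-Killing
  equation shows that \<open>(\<nabla>\<^sub>u\<Omega>)(u, Y, Z, W)\<close> is the same for all unit vectors \<open>u\<close> orthogonal to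
  \<open>Y, Z, W\<close>. Let \<open>b\<close> be orthogonal to the quaternionic line of \<open>a\<close>. Moving \<open>u\<close> from \<open>a\<close> to \<open>J\<^sub>1 a\<close> with
  \<open>(Y, Z, W) = (J\<^sub>2 a, b, J\<^sub>3 b)\<close>, where the new value vanishes identically, gives that \<open>S\<^sub>1(a)\<close> has the same
  Rayleigh quotient at \<open>a\<close> and \<open>b\<close>. Moving \<open>u\<close> from \<open>a\<close> to \<open>J\<^sub>3 b\<close> with \<open>(Y, Z, W) = (J\<^sub>1 a, J\<^sub>2 a, b)\<close> gives
  that \<open>S\<^sub>3(a) a + J\<^sub>2 S\<^sub>1(a) a - J\<^sub>1 S\<^sub>2(a) a\<close> is orthogonal to \<open>b\<close>. With the cyclic permutations of this
  relation, all \<open>S\<^sub>i(a) a\<close> lie in the quaternionic line of \<open>a\<close>, and so \<open>S\<^sub>i(a)\<close> is scalar.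
\<close>

section \<open>The pointwise argument\<close>

text \<open>For alternating forms this is the wedge product, expanded over the six
  (2,2)-shuffles.\<close>

definition wedge22 :: "('e \<Rightarrow> 'e \<Rightarrow> real) \<Rightarrow> ('e \<Rightarrow> 'e \<Rightarrow> real) \<Rightarrow> 'e \<Rightarrow> 'e \<Rightarrow> 'e \<Rightarrow> 'e \<Rightarrow> real" where
  "wedge22 \<alpha> \<beta> X Y Z W =
     \<alpha> X Y * \<beta> Z W - \<alpha> X Z * \<beta> Y W + \<alpha> X W * \<beta> Y Z + \<beta> X Y * \<alpha> Z W - \<beta> X Z * \<alpha> Y W + \<beta> X W * \<alpha> Y Z"

text \<open>Half the derivative of \<open>\<Omega>\<close> when each \<open>J\<^sub>i\<close> varies
  by \<open>A\<^sub>i\<close> at fixed metric; the half appears because \<open>wedge22\<close> is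
  symmetric in its two forms.\<close>

definition four_form_variation ::
  "'e::euclidean_space bilin \<Rightarrow> ('e \<Rightarrow>\<^sub>L 'e) \<Rightarrow> ('e \<Rightarrow>\<^sub>L 'e) \<Rightarrow> ('e \<Rightarrow>\<^sub>L 'e) \<Rightarrow>
    ('e \<Rightarrow>\<^sub>L 'e) \<Rightarrow> ('e \<Rightarrow>\<^sub>L 'e) \<Rightarrow> ('e \<Rightarrow>\<^sub>L 'e) \<Rightarrow> 'e \<Rightarrow> 'e \<Rightarrow> 'e \<Rightarrow> 'e \<Rightarrow> real" where
  "four_form_variation G J1 J2 J3 A1 A2 A3 X Y Z W =
     wedge22 (\<lambda>x y. G (A1 x) y) (\<lambda>x y. G (J1 x) y) X Y Z W +
     wedge22 (\<lambda>x y. G (A2 x) y) (\<lambda>x y. G (J2 x) y) X Y Z W +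
     wedge22 (\<lambda>x y. G (A3 x) y) (\<lambda>x y. G (J3 x) y) X Y Z W"

text \<open>Together with the \<open>rotate\<close> lemmas, this cyclic symmetry transfers results
  about one of the \<open>S\<^sub>i\<close> to the other two.\<close>

lemma four_form_variation_rotate:
  "four_form_variation G J2 J3 J1 A2 A3 A1 = four_form_variation G J1 J2 J3 A1 A2 A3"
  by (simp add: four_form_variation_def fun_eq_iff)

section \<open>Linear algebra of a quaternionic frame at one point\<close>

locale quaternionic_frame =
  fixes G :: "'e::euclidean_space bilin" and J1 J2 J3 :: "'e \<Rightarrow>\<^sub>L 'e"
  assumes sym: "G x y = G y x" and pos: "x \<noteq> 0 \<Longrightarrow> G x x > 0"
    and skew1: "G x (J1 y) = - G (J1 x) y"
    and skew2: "G x (J2 y) = - G (J2 x) y"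
    and skew3: "G x (J3 y) = - G (J3 x) y"
    and J11: "J1 (J1 x) = - x" and J22: "J2 (J2 x) = - x" and J33: "J3 (J3 x) = - x"
    and J12: "J1 (J2 x) = J3 x" and J23: "J2 (J3 x) = J1 x" and J31: "J3 (J1 x) = J2 x"
    and J21: "J2 (J1 x) = - J3 x" and J32: "J3 (J2 x) = - J1 x" and J13: "J1 (J3 x) = - J2 x"
begin

text \<open>As rewrite rules, \<open>skews\<close> moves every \<open>J\<^sub>i\<close> into the
  first argument of \<open>G\<close>, where \<open>mult_table\<close> reduces products to a single
  \<open>J\<^sub>i\<close> up to sign.\<close>

lemmas mult_table = J11 J22 J33 J12 J23 J31 J21 J32 J13
lemmas skews = skew1 skew2 skew3

lemma rotate: "quaternionic_frame G J2 J3 J1"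
  by unfold_locales (fact sym skews mult_table | erule pos)+

lemma self_orthogonal: "G (J1 x) x = 0" "G (J2 x) x = 0" "G (J3 x) x = 0"
  using skews[of x x] sym by (metis equal_neg_zero)+

lemma orthogonal_images:
  "G (J1 x) (J1 y) = G x y" "G (J2 x) (J2 y) = G x y" "G (J3 x) (J3 y) = G x y"
  by (simp_all add: skews mult_table blinfun.bilinear_simps)

text \<open>The part \<open>P = (A\<^sub>2 + J\<^sub>1 A\<^sub>2 J\<^sub>1) / 2\<close> of
  \<open>A\<^sub>2\<close> anticommutes with \<open>J\<^sub>1\<close> and \<open>J\<^sub>2\<close>,
  hence commutes with \<open>J\<^sub>3\<close>. So \<open>S = - J\<^sub>3 P\<close> commutes with
  all three, and it is symmetric as a product of commuting skew endomorphisms.\<close>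

lemma torsion_component:
  fixes A2 :: "'e \<Rightarrow>\<^sub>L 'e"
  assumes skew: "\<And>x y. G x (A2 y) = - G (A2 x) y"
    and anti: "\<And>x. A2 (J2 x) = - J2 (A2 x)"
  defines "S \<equiv> (-1/2) *\<^sub>R (J3 o\<^sub>L (A2 + (J1 o\<^sub>L A2 o\<^sub>L J1)))"
  shows "S (J1 x) = J1 (S x)" "S (J2 x) = J2 (S x)" "S (J3 x) = J3 (S x)" "G x (S y) = G (S x) y"
proof -
  have S: "S x = (1/2) *\<^sub>R (- J3 (A2 x) - J2 (A2 (J1 x)))" for x
    by (simp add: S_def blinfun.bilinear_simps mult_table algebra_simps)
  have anti': "A2 (J3 x) = J2 (A2 (J1 x))" for x
    using anti[of "J1 x"] by (simp add: mult_table blinfun.bilinear_simps)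
  show "S (J1 x) = J1 (S x)" "S (J2 x) = J2 (S x)" "S (J3 x) = J3 (S x)"
    by (simp_all add: S blinfun.bilinear_simps mult_table anti anti' algebra_simps)
  show "G x (S y) = G (S x) y"
    by (simp add: S blinfun.bilinear_simps mult_table skews skew anti anti')
qed

definition h_orthogonal :: "'e \<Rightarrow> 'e \<Rightarrow> bool" where
  "h_orthogonal a b \<longleftrightarrow> G a b = 0 \<and> G (J1 a) b = 0 \<and> G (J2 a) b = 0 \<and> G (J3 a) b = 0"

lemma h_orthogonal_images:
  assumes "h_orthogonal a b"
  shows "h_orthogonal a (J1 b)" "h_orthogonal a (J2 b)" "h_orthogonal a (J3 b)"
  using assms unfolding h_orthogonal_def by (simp_all add: skews mult_table blinfun.bilinear_simps)

lemma h_orthogonal_sym: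
  assumes "h_orthogonal a b"
  shows "h_orthogonal b a"
  using assms sym[of _ b] skews unfolding h_orthogonal_def by (metis neg_equal_0_iff_equal)

end

text \<open>
  Here \<open>D u\<close> plays the role of \<open>\<nabla>\<^sub>u\<Omega> / 2\<close>, with \<open>\<nabla>\<^sub>u J\<^sub>1 = J\<^sub>2 S\<^sub>3 - J\<^sub>3 S\<^sub>2\<close> and its cyclic
  permutations. The assumption \<open>conformal\<close> says that \<open>D u(u, Y, Z, W)\<close>,
  restricted to \<open>Y, Z, W\<close> orthogonal to \<open>u\<close>, is \<open>|u|\<^sup>2\<close> times a form that does not depend on \<open>u\<close>.
\<close>

locale quaternionic_torsion = quaternionic_frame +
  fixes S1 S2 S3 :: "'a \<Rightarrow> 'a \<Rightarrow>\<^sub>L 'a"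
  assumes selfadjoint: "G x (S1 u y) = G (S1 u x) y" "G x (S2 u y) = G (S2 u x) y"
      "G x (S3 u y) = G (S3 u x) y"
    and comm1: "S1 u (J1 x) = J1 (S1 u x)" "S1 u (J2 x) = J2 (S1 u x)" "S1 u (J3 x) = J3 (S1 u x)"
    and comm2: "S2 u (J1 x) = J1 (S2 u x)" "S2 u (J2 x) = J2 (S2 u x)" "S2 u (J3 x) = J3 (S2 u x)"
    and comm3: "S3 u (J1 x) = J1 (S3 u x)" "S3 u (J2 x) = J2 (S3 u x)" "S3 u (J3 x) = J3 (S3 u x)"
  fixes D
  assumes D: "D u = four_form_variation G J1 J2 J3 ((J2 o\<^sub>L S3 u) - (J3 o\<^sub>L S2 u))
      ((J3 o\<^sub>L S1 u) - (J1 o\<^sub>L S3 u)) ((J1 o\<^sub>L S2 u) - (J2 o\<^sub>L S1 u))"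
    and conformal: "\<lbrakk>G u Y = 0; G u Z = 0; G u W = 0; G v Y = 0; G v Z = 0; G v W = 0\<rbrakk>
      \<Longrightarrow> G v v * D u u Y Z W = G u u * D v v Y Z W"
begin

lemmas comms = comm1 comm2 comm3

section \<open>Values of \<open>D\<close> on adapted vectors, and scalarity of the
  \<open>S\<^sub>i\<close>\<close>

lemma rotate: "quaternionic_torsion G J2 J3 J1 S2 S3 S1 D"
proof -
  interpret rot: quaternionic_frame G J2 J3 J1 by (rule rotate)
  show ?thesis
    by unfold_locales (fact selfadjoint comms | erule (5) conformal | simp only: D four_form_variation_rotate)+
qed

text \<open>Each \<open>J\<^sub>i S\<^sub>j\<close> is skew, being a product of commuting skew and
  symmetric endomorphisms.\<close>

lemma S_skew:
  "G (J1 (S1 u x)) x = 0" "G (J2 (S1 u x)) x = 0" "G (J3 (S1 u x)) x = 0"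
  "G (J1 (S2 u x)) x = 0" "G (J2 (S2 u x)) x = 0" "G (J3 (S2 u x)) x = 0"
  "G (J1 (S3 u x)) x = 0" "G (J2 (S3 u x)) x = 0" "G (J3 (S3 u x)) x = 0"
proof -
  have *: "G (J (S x)) x = 0" if "\<And>x y. G x (J y) = - G (J x) y" "\<And>x y. G x (S y) = G (S x) y"
    "\<And>x. S (J x) = J (S x)" for J S :: "'a \<Rightarrow>\<^sub>L 'a"
    using that sym by (metis equal_neg_zero)
  show "G (J1 (S1 u x)) x = 0" "G (J2 (S1 u x)) x = 0" "G (J3 (S1 u x)) x = 0"
  "G (J1 (S2 u x)) x = 0" "G (J2 (S2 u x)) x = 0" "G (J3 (S2 u x)) x = 0"
  "G (J1 (S3 u x)) x = 0" "G (J2 (S3 u x)) x = 0" "G (J3 (S3 u x)) x = 0"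
    by (rule *; fact skews selfadjoint comms)+
qed

context
  fixes a b :: 'a
  assumes ab: "h_orthogonal a b"
begin

lemma zero_products:
  "G a b = 0" "G (J1 a) b = 0" "G (J2 a) b = 0" "G (J3 a) b = 0"
  "G b a = 0" "G (J1 b) a = 0" "G (J2 b) a = 0" "G (J3 b) a = 0"
  using ab h_orthogonal_sym[OF ab] unfolding h_orthogonal_def by auto

lemmas D_simps = D four_form_variation_def wedge22_def blinfun.bilinear_simps skews mult_table
  selfadjoint comms self_orthogonal S_skew zero_products

text \<open>Both \<open>(J\<^sub>1 a, J\<^sub>2 a)\<close> and \<open>(b, J\<^sub>3 b)\<close> have
  the form \<open>(v, J\<^sub>3 v)\<close>. There \<open>\<omega>\<^sub>1\<close> and
  \<open>\<omega>\<^sub>2\<close> vanish, and so does the form of \<open>A\<^sub>3\<close>, because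
  \<open>J\<^sub>3 A\<^sub>3\<close> is skew. The second value uses the same four vectors in another
  order.\<close>

lemma D_same_type: "D u (J1 a) (J2 a) b (J3 b) = 0" "D u (J3 b) (J1 a) (J2 a) b = 0"
  by (simp_all add: D_simps)

text \<open>Only \<open>\<omega>\<^sub>2\<close> survives on \<open>(a, J\<^sub>2 a)\<close> and
  only \<open>\<omega>\<^sub>3\<close> on \<open>(b, J\<^sub>3 b)\<close>. This leaves
  \<open>A\<^sub>2\<close> on the second pair and \<open>A\<^sub>3\<close> on the first, where
  \<open>S_skew\<close> kills all but the \<open>S\<^sub>1\<close> terms.\<close>

lemma D_mixed_type:
  "D u a (J2 a) b (J3 b) = G a a * G (S1 u b) b - G b b * G (S1 u a) a"
  by (simp add: D_simps)

text \<open>Every \<open>\<omega>\<^sub>i\<close> pairs \<open>b\<close> to zero with the other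
  three vectors, so \<open>b\<close> enters only through the factors
  \<open>A\<^sub>i\<close>.\<close>

lemma D_three_one:
  "D u a (J1 a) (J2 a) b = - 2 * G a a * G (S3 u a + J2 (S1 u a) - J1 (S2 u a)) b"
  by (simp add: D_simps) (simp add: algebra_simps)

lemma diagonal: "G a a * G (S1 a b) b = G b b * G (S1 a a) a"
proof (cases "a = 0")
  case False
  have "G (J1 a) (J1 a) * D a a (J2 a) b (J3 b) = G a a * D (J1 a) (J1 a) (J2 a) b (J3 b)"
    by (rule conformal) (simp_all add: D_simps)
  then show ?thesis
    using pos[OF False] D_mixed_type D_same_type(1) by (simp add: orthogonal_images)
qed (simp add: blinfun.bilinear_simps)

lemma off_diagonal_aux:
  assumes "a \<noteq> 0"
  shows "G (S3 a a + J2 (S1 a a) - J1 (S2 a a)) b = 0"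
proof (cases "b = 0")
  case False
  have "G (J3 b) (J3 b) * D a a (J1 a) (J2 a) b = G a a * D (J3 b) (J3 b) (J1 a) (J2 a) b"
    by (rule conformal) (simp_all add: D_simps)
  then show ?thesis
    using pos[OF False] pos[OF assms] D_same_type(2) D_three_one by (simp add: orthogonal_images)
qed (simp add: blinfun.bilinear_simps)

end


lemma off_diagonal:
  assumes "a \<noteq> 0" "h_orthogonal a b"
  shows "G (S3 a a) b = 0"
proof -
  interpret r1: quaternionic_torsion G J2 J3 J1 S2 S3 S1 D by (rule rotate)
  interpret r2: quaternionic_torsion G J3 J1 J2 S3 S1 S2 D by (rule r1.rotate)
  have rot: "r1.h_orthogonal x y = h_orthogonal x y" "r2.h_orthogonal x y = h_orthogonal x y" for x y
    unfolding h_orthogonal_def r1.h_orthogonal_def r2.h_orthogonal_def by auto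
  \<comment> \<open>With \<open>p, q, r\<close> the products of \<open>S3 a a\<close>,
    \<open>J2 (S1 a a)\<close>, \<open>J1 (S2 a a)\<close> with \<open>b\<close>, the relation at
    \<open>b\<close> and its rotations at \<open>J2 b\<close> and \<open>J1 b\<close> read
    \<open>p + q - r = 0\<close>, \<open>p + q + r = 0\<close>, \<open>p - q - r = 0\<close>; hence
    \<open>p = 0\<close>.\<close>
  have "G (S3 a a + J2 (S1 a a) - J1 (S2 a a)) b = 0"
    using off_diagonal_aux assms by blast
  moreover have "G (S1 a a + J3 (S2 a a) - J2 (S3 a a)) (J2 b) = 0"
    by (rule r1.off_diagonal_aux) (use assms in \<open>simp_all add: rot h_orthogonal_images\<close>)
  moreover have "G (S2 a a + J1 (S3 a a) - J3 (S1 a a)) (J1 b) = 0"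
    by (rule r2.off_diagonal_aux) (use assms in \<open>simp_all add: rot h_orthogonal_images\<close>)
  ultimately show ?thesis
    by (simp add: blinfun.bilinear_simps skews mult_table)
qed

lemma off_diagonal1:
  assumes "a \<noteq> 0" "h_orthogonal a b"
  shows "G (S1 a a) b = 0"
proof -
  interpret r1: quaternionic_torsion G J2 J3 J1 S2 S3 S1 D by (rule rotate)
  show ?thesis
    using r1.off_diagonal[of a b] assms unfolding h_orthogonal_def r1.h_orthogonal_def by auto
qed

text \<open>The quadratic form of \<open>S1 u\<close> is \<open>l\<close> times the metric on the
  quaternionic line of \<open>u\<close> and on its complement, with no cross terms; polarisation
  turns this into an identity of endomorphisms.\<close>

lemma S1_scalar:
  assumes "u \<noteq> 0"
  shows "S1 u x = (G (S1 u u) u / G u u) *\<^sub>R x"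
proof -
  define l where "l = G (S1 u u) u / G u u"
  have G: "G u u > 0" using pos assms .
  have l: "l * G u u = G (S1 u u) u" using G by (simp add: l_def)
  have quad: "G (S1 u x) x = l * G x x" for x
  proof -
    \<comment> \<open>the component of \<open>x\<close> in the quaternionic line of \<open>u\<close>\<close>
    define h where "h = (1 / G u u) *\<^sub>R (G u x *\<^sub>R u + G (J1 u) x *\<^sub>R J1 u + G (J2 u) x *\<^sub>R J2 u + G (J3 u) x *\<^sub>R J3 u)"
    define b where "b = x - h"
    have b: "h_orthogonal u b"
      unfolding h_orthogonal_def b_def h_def using G
      by (simp add: blinfun.bilinear_simps skews mult_table self_orthogonal)
    note z = zero_products[OF b]
    note z' = h_orthogonal_images[OF b, unfolded h_orthogonal_def]
    have hb: "G h b = 0"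
      unfolding h_def by (simp add: z blinfun.bilinear_simps)
    have hb': "G (S1 u h) b = 0"
      unfolding h_def using off_diagonal1[OF assms b] off_diagonal1[OF assms h_orthogonal_images(1)[OF b]]
        off_diagonal1[OF assms h_orthogonal_images(2)[OF b]] off_diagonal1[OF assms h_orthogonal_images(3)[OF b]]
      by (simp add: skews blinfun.bilinear_simps comms)
    \<comment> \<open>On the line of \<open>u\<close> the quotient stays \<open>l\<close>, since
      \<open>S1 u\<close> commutes with the isometries \<open>J\<^sub>i\<close>; cross terms vanish
      by \<open>S_skew\<close>.\<close>
    have hh: "G (S1 u h) h = l * G h h"
      unfolding h_def
      by (simp add: blinfun.bilinear_simps skews mult_table self_orthogonal S_skew comms) (simp add: algebra_simps flip: l)
    have bb: "G (S1 u b) b = l * G b b"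
      using diagonal[OF b] G by (simp add: l_def field_simps)
    have x: "x = h + b" by (simp add: b_def)
    show ?thesis
      unfolding x using hb hb' hh bb sym[of b h] sym[of "S1 u b" h]
      by (simp add: blinfun.bilinear_simps selfadjoint distrib_left)
  qed
  have polar: "G (S1 u x) y = l * G x y" for x y
    using quad[of x] quad[of y] quad[of "x + y"] sym[of y x] sym[of "S1 u y" x]
    by (simp add: blinfun.bilinear_simps selfadjoint distrib_left)
  have "G (S1 u x - l *\<^sub>R x) y = 0" for y
    using polar by (simp add: blinfun.bilinear_simps)
  then show ?thesis
    using pos[of "S1 u x - l *\<^sub>R x"] by (force simp: l_def)
qed

end


text \<open>Recovers the \<open>S\<^sub>i\<close> from
  \<open>A\<^sub>i = \<nabla>\<^sub>u J\<^sub>i\<close> through \<open>torsion_component\<close>.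
  Once they are scalar, each \<open>A\<^sub>i\<close> is a combination of the
  \<open>J\<^sub>j\<close>.\<close>

lemma (in quaternionic_frame) span_if_conformal:
  fixes A1 A2 A3 :: "'e \<Rightarrow> 'e \<Rightarrow>\<^sub>L 'e"
  assumes skew: "\<And>u x y. G x (A1 u y) = - G (A1 u x) y" "\<And>u x y. G x (A2 u y) = - G (A2 u x) y"
      "\<And>u x y. G x (A3 u y) = - G (A3 u x) y"
    and anti: "\<And>u x. A1 u (J1 x) = - J1 (A1 u x)" "\<And>u x. A2 u (J2 x) = - J2 (A2 u x)"
      "\<And>u x. A3 u (J3 x) = - J3 (A3 u x)"
    and leibniz: "\<And>u x. A3 u x = A1 u (J2 x) + J1 (A2 u x)"
    and conformal: "\<And>u v Y Z W. \<lbrakk>G u Y = 0; G u Z = 0; G u W = 0; G v Y = 0; G v Z = 0; G v W = 0\<rbrakk>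
      \<Longrightarrow> G v v * four_form_variation G J1 J2 J3 (A1 u) (A2 u) (A3 u) u Y Z W =
          G u u * four_form_variation G J1 J2 J3 (A1 v) (A2 v) (A3 v) v Y Z W"
    and "u \<noteq> 0"
  shows "A1 u \<in> span {J1, J2, J3}" "A2 u \<in> span {J1, J2, J3}" "A3 u \<in> span {J1, J2, J3}"
proof -
  interpret r1: quaternionic_frame G J2 J3 J1 by (rule rotate)
  interpret r2: quaternionic_frame G J3 J1 J2 by (rule r1.rotate)
  define S1 where "S1 u = (-1/2) *\<^sub>R (J3 o\<^sub>L (A2 u + (J1 o\<^sub>L A2 u o\<^sub>L J1)))" for u
  define S2 where "S2 u = (-1/2) *\<^sub>R (J1 o\<^sub>L (A3 u + (J2 o\<^sub>L A3 u o\<^sub>L J2)))" for u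
  define S3 where "S3 u = (-1/2) *\<^sub>R (J2 o\<^sub>L (A1 u + (J3 o\<^sub>L A1 u o\<^sub>L J3)))" for u
  have anti': "A1 u (J3 x) = - J1 (A1 u (J2 x))" "A2 u (J3 x) = J2 (A2 u (J1 x))" for u x
    using anti(1)[of u "J2 x"] anti(2)[of u "J1 x"] by (simp_all add: mult_table blinfun.bilinear_simps)
  \<comment> \<open>Each \<open>A\<^sub>i\<close> determines two of the \<open>S\<^sub>j\<close>.
    Inserting \<open>leibniz\<close> into the anticommutation of \<open>A\<^sub>3\<close> with
    \<open>J\<^sub>3\<close> expresses \<open>A\<^sub>2 - J\<^sub>1 A\<^sub>2 J\<^sub>1\<close>, the
    part commuting with \<open>J\<^sub>1\<close>, by \<open>A\<^sub>1\<close>: both yield the same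
    \<open>S\<^sub>3\<close>.\<close>
  have A2: "A2 u x = J3 (A1 u x) + J1 (A1 u (J2 x)) + J1 (A2 u (J1 x))" for u x
    using arg_cong[OF anti(3)[of u x], of J2]
    by (simp add: leibniz anti anti' mult_table blinfun.bilinear_simps algebra_simps)
  have A2': "J1 (A2 u x) + (J2 (A1 u x) + (A1 u (J2 x) + A2 u (J1 x))) = 0" for u x
    using arg_cong[OF A2[of u x], of J1] by (simp add: mult_table blinfun.bilinear_simps)
  have dbl: "x = y" if "x + x = y + y" for x y :: 'e
    using that by (metis scaleR_2 scaleR_cancel_left zero_neq_numeral)
  have half: "(1/2) *\<^sub>R x + (1/2) *\<^sub>R x = x" for x :: 'e
    by (metis scaleR_half_double scaleR_add_right)
  have A: "A1 u = (J2 o\<^sub>L S3 u) - (J3 o\<^sub>L S2 u)" "A2 u = (J3 o\<^sub>L S1 u) - (J1 o\<^sub>L S3 u)"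
    "A3 u = (J1 o\<^sub>L S2 u) - (J2 o\<^sub>L S1 u)" for u
    by (rule blinfun_eqI, rule dbl, simp add: S1_def S2_def S3_def blinfun.bilinear_simps mult_table anti anti' leibniz half algebra_simps, (rule A2[unfolded add.assoc] A2')?)+
  have s1: "S1 u (J1 x) = J1 (S1 u x)" "S1 u (J2 x) = J2 (S1 u x)" "S1 u (J3 x) = J3 (S1 u x)"
      "G x (S1 u y) = G (S1 u x) y" for u x y
    using torsion_component[of "A2 u", OF skew(2) anti(2)] unfolding S1_def by blast+
  have s2: "S2 u (J1 x) = J1 (S2 u x)" "S2 u (J2 x) = J2 (S2 u x)" "S2 u (J3 x) = J3 (S2 u x)"
      "G x (S2 u y) = G (S2 u x) y" for u x y
    using r1.torsion_component[of "A3 u", OF skew(3) anti(3)] unfolding S2_def by blast+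
  have s3: "S3 u (J1 x) = J1 (S3 u x)" "S3 u (J2 x) = J2 (S3 u x)" "S3 u (J3 x) = J3 (S3 u x)"
      "G x (S3 u y) = G (S3 u x) y" for u x y
    using r2.torsion_component[of "A1 u", OF skew(1) anti(1)] unfolding S3_def by blast+
  interpret T: quaternionic_torsion G J1 J2 J3 S1 S2 S3 "\<lambda>u. four_form_variation G J1 J2 J3 (A1 u) (A2 u) (A3 u)"
    by unfold_locales (fact s1 s2 s3 | erule (5) conformal | simp only: A[symmetric])+
  interpret T1: quaternionic_torsion G J2 J3 J1 S2 S3 S1 "\<lambda>u. four_form_variation G J1 J2 J3 (A1 u) (A2 u) (A3 u)"
    by (rule T.rotate)
  interpret T2: quaternionic_torsion G J3 J1 J2 S3 S1 S2 "\<lambda>u. four_form_variation G J1 J2 J3 (A1 u) (A2 u) (A3 u)"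
    by (rule T1.rotate)
  obtain l1 l2 l3 where S: "S1 u x = l1 *\<^sub>R x" "S2 u x = l2 *\<^sub>R x" "S3 u x = l3 *\<^sub>R x" for x
    using T.S1_scalar T1.S1_scalar T2.S1_scalar \<open>u \<noteq> 0\<close> by metis
  have "A1 u = l3 *\<^sub>R J2 - l2 *\<^sub>R J3" "A2 u = l1 *\<^sub>R J3 - l3 *\<^sub>R J1" "A3 u = l2 *\<^sub>R J1 - l1 *\<^sub>R J2"
    unfolding A by (rule blinfun_eqI, simp add: blinfun.bilinear_simps S)+
  then show "A1 u \<in> span {J1, J2, J3}" "A2 u \<in> span {J1, J2, J3}" "A3 u \<in> span {J1, J2, J3}"
    by (simp_all add: span_diff span_scale span_base)
qed

section \<open>Wedge products of 2-forms and of 1-forms with 3-forms\<close>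

text \<open>Each permutation of four points is uniquely a product of transpositions
  \<open>(0 i) (1 j) (2 k)\<close>, where equal entries mean the identity. The sign can be read off
  the factors.\<close>

lemma sum_permutes_lessThan_4:
  fixes f :: "(nat \<Rightarrow> nat) \<Rightarrow> real"
  shows "sum f {\<sigma>. \<sigma> permutes {..<4}} =
    (\<Sum>i\<leftarrow>[0,1,2,3]. \<Sum>j\<leftarrow>[1,2,3]. \<Sum>k\<leftarrow>[2,3]. f (Transposition.transpose 0 i \<circ> (Transposition.transpose 1 j \<circ> Transposition.transpose 2 k)))"
proof -
  have 4: "{..<4::nat} = insert 0 (insert 1 (insert 2 (insert 3 {})))" by auto
  show ?thesis unfolding 4
    by (simp add: sum_over_permutations_insert flip: id_def)
qed

lemma sum_sign_permutes_lessThan_4: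
  fixes f :: "(nat \<Rightarrow> nat) \<Rightarrow> real"
  shows "(\<Sum>\<sigma> | \<sigma> permutes {..<4}. of_int (sign \<sigma>) * f \<sigma>) =
    (\<Sum>i\<leftarrow>[0,1,2,3]. \<Sum>j\<leftarrow>[1,2,3]. \<Sum>k\<leftarrow>[2,3].
      (if i = 0 then 1 else -1) * (if j = 1 then 1 else -1) * (if k = 2 then 1 else -1) *
      f (Transposition.transpose 0 i \<circ> (Transposition.transpose 1 j \<circ> Transposition.transpose 2 k)))"
proof -
  have "sign (Transposition.transpose 0 i \<circ> (Transposition.transpose 1 j \<circ> Transposition.transpose 2 k)) =
    (if i = 0 then 1 else -1) * (if j = 1 then 1 else -1) * (if k = 2 then 1 else (-1::int))" for i j k :: nat
    by (simp add: sign_compose permutation_compose permutation_swap_id sign_swap_id)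
  then show ?thesis
    unfolding sum_permutes_lessThan_4 by (simp only: of_int_mult of_int_1 of_int_minus if_distrib[of of_int])
qed

lemma wedge_2_2:
  assumes "\<And>x y. \<alpha> [y, x] = - \<alpha> [x, y]" "\<And>x y. \<beta> [y, x] = - \<beta> [x, y]"
  shows "wedge 2 2 \<alpha> \<beta> [X, Y, Z, W] = wedge22 (\<lambda>x y. \<alpha> [x, y]) (\<lambda>x y. \<beta> [x, y]) X Y Z W"
proof -
  have add_2_2: "2 + 2 = (4::nat)" "1 + 3 = (4::nat)" by simp_all
  have 2: "[0..<2] = [0, 1]" "[2..<4] = [2, 3::nat]" by (simp_all add: upt_conv_Cons)
  show ?thesis
    unfolding wedge_def wedge22_def
    using assms[of X Y] assms[of X Z] assms[of X W] assms[of Y Z] assms[of Y W] assms[of Z W]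
    by (simp only: add_2_2 mult.assoc sum_sign_permutes_lessThan_4) (simp add: 2 Transposition.transpose_def fact_numeral)
qed

text \<open>Only the permutations placing \<open>u\<close> in the slot of \<open>flat G u\<close>
  contribute. As \<open>\<beta>\<close> is an arbitrary function on lists, its alternation over
  \<open>Y, Z, W\<close> is kept as a sum; it does not involve \<open>u\<close>.\<close>

lemma wedge_flat_3:
  fixes G :: "'e::euclidean_space bilin"
  assumes "G u Y = 0" "G u Z = 0" "G u W = 0"
  shows "wedge 1 3 (flat G u) \<beta> [u, Y, Z, W] =
    G u u * (\<beta> [Y, Z, W] - \<beta> [Y, W, Z] - \<beta> [Z, Y, W] + \<beta> [Z, W, Y] + \<beta> [W, Y, Z] - \<beta> [W, Z, Y]) / 6"
proof -
  have add_2_2: "2 + 2 = (4::nat)" "1 + 3 = (4::nat)" by simp_all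
  have 2: "[0..<Suc 0] = [0]" "[Suc 0..<4] = [1, 2, 3::nat]" by (simp_all add: upt_conv_Cons)
  show ?thesis
    unfolding wedge_def flat_def using assms
    by (simp only: add_2_2 mult.assoc sum_sign_permutes_lessThan_4) (simp add: 2 Transposition.transpose_def fact_numeral algebra_simps)
qed

section \<open>Covariant derivatives in a chart\<close>

lemma cov_deriv_endo_eq:
  assumes "(B has_derivative B') (at x)"
  shows "cov_deriv_endo G B x u = B' u + (levi_civita G x u o\<^sub>L B x) - (B x o\<^sub>L levi_civita G x u)"
  unfolding cov_deriv_endo_def using frechet_derivative_at[OF assms] by metis

lemma cov_deriv_endo_cong:
  assumes "(B has_derivative B') (at x)" "open U" "x \<in> U" "\<And>y. y \<in> U \<Longrightarrow> B y = C y"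
  shows "cov_deriv_endo G B x = cov_deriv_endo G C x"
  using cov_deriv_endo_eq[OF assms(1)] assms(4)[OF assms(3)]
    cov_deriv_endo_eq[OF has_derivative_transform_within_open[OF assms]] by (simp add: fun_eq_iff)

lemma cov_deriv_endo_compose:
  assumes "(B has_derivative B') (at x)" "(C has_derivative C') (at x)"
  shows "cov_deriv_endo G (\<lambda>y. B y o\<^sub>L C y) x u =
    (cov_deriv_endo G B x u o\<^sub>L C x) + (B x o\<^sub>L cov_deriv_endo G C x u)"
proof -
  have "((\<lambda>y. B y o\<^sub>L C y) has_derivative (\<lambda>u. (B x o\<^sub>L C' u) + (B' u o\<^sub>L C x))) (at x)"
    by (rule bounded_bilinear.FDERIV[OF bounded_bilinear_blinfun_compose assms])
  from cov_deriv_endo_eq[OF this] show ?thesis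
    unfolding cov_deriv_endo_eq[OF assms(1)] cov_deriv_endo_eq[OF assms(2)]
    by (auto intro!: blinfun_eqI simp: blinfun.bilinear_simps)
qed

lemma cov_deriv_endo_minus_id: "cov_deriv_endo G (\<lambda>y. - id_blinfun) x u = 0"
  by (subst cov_deriv_endo_eq[OF has_derivative_const]) (auto intro!: blinfun_eqI simp: blinfun.bilinear_simps)

lemma cov_deriv_endo_scaleR:
  assumes "(f has_derivative f') (at x)" "(B has_derivative B') (at x)"
  shows "cov_deriv_endo G (\<lambda>y. f y *\<^sub>R B y) x u = f' u *\<^sub>R B x + f x *\<^sub>R cov_deriv_endo G B x u"
proof -
  have D: "((\<lambda>y. f y *\<^sub>R B y) has_derivative (\<lambda>u. f x *\<^sub>R B' u + f' u *\<^sub>R B x)) (at x)"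
    by (rule has_derivative_scaleR[OF assms])
  show ?thesis
    unfolding cov_deriv_endo_eq[OF D] cov_deriv_endo_eq[OF assms(2)]
    by (auto intro!: blinfun_eqI simp: blinfun.bilinear_simps algebra_simps)
qed

lemma cov_deriv_endo_add:
  assumes "(B has_derivative B') (at x)" "(C has_derivative C') (at x)"
  shows "cov_deriv_endo G (\<lambda>y. B y + C y) x u = cov_deriv_endo G B x u + cov_deriv_endo G C x u"
  unfolding cov_deriv_endo_eq[OF has_derivative_add[OF assms]] cov_deriv_endo_eq[OF assms(1)]
     cov_deriv_endo_eq[OF assms(2)]
  by (auto intro!: blinfun_eqI simp: blinfun.bilinear_simps algebra_simps)

text \<open>The product rule with \<open>\<nabla>g = 0\<close>. The vectors \<open>X, Y\<close> are
  constant in the chart, so the connection acting on them gives the last two terms.\<close>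

lemma has_derivative_bilin_endo:
  fixes G :: "'e::euclidean_space \<Rightarrow> 'e bilin" and B :: "'e \<Rightarrow> 'e \<Rightarrow>\<^sub>L 'e"
  assumes G: "(G has_derivative G') (at x)" and LC: "is_levi_civita G x (levi_civita G x)"
    and B: "(B has_derivative B') (at x)"
  shows "((\<lambda>y. G y (B y X) Y) has_derivative (\<lambda>u. G x (cov_deriv_endo G B x u X) Y +
    G x (B x (levi_civita G x u X)) Y + G x (B x X) (levi_civita G x u Y))) (at x)"
proof -
  have "((\<lambda>y. G y v w) has_derivative (\<lambda>z. G' z v w)) (at x)" for v w
    by (auto intro!: derivative_eq_intros G ext simp: blinfun.bilinear_simps)
  then have G'_eq: "G' u v w = G x (levi_civita G x u v) w + G x v (levi_civita G x u w)" for u v w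
    using frechet_derivative_at LC unfolding is_levi_civita_def by metis
  have "((\<lambda>y. G y (B y X) Y) has_derivative (\<lambda>u. G' u (B x X) Y + G x (B' u X) Y)) (at x)"
    by (auto intro!: derivative_eq_intros G B ext simp: blinfun.bilinear_simps)
  then show ?thesis
    by (simp add: G'_eq cov_deriv_endo_eq[OF B] blinfun.bilinear_simps algebra_simps)
qed

lemma (in quaternionic_frame) four_form_eq_wedge22:
  "four_form G J1 J2 J3 [X, Y, Z, W] =
     wedge22 (\<lambda>x y. G (J1 x) y) (\<lambda>x y. G (J1 x) y) X Y Z W +
     wedge22 (\<lambda>x y. G (J2 x) y) (\<lambda>x y. G (J2 x) y) X Y Z W +
     wedge22 (\<lambda>x y. G (J3 x) y) (\<lambda>x y. G (J3 x) y) X Y Z W"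
proof -
  have k: "kaehler_form G J [x, y] = G (J x) y" for J :: "'e \<Rightarrow>\<^sub>L 'e" and x y
    by (simp add: kaehler_form_def)
  have "wedge 2 2 (kaehler_form G J) (kaehler_form G J) [X, Y, Z, W] =
      wedge22 (\<lambda>x y. G (J x) y) (\<lambda>x y. G (J x) y) X Y Z W"
    if "\<And>x y. G x (J y) = - G (J x) y" for J :: "'e \<Rightarrow>\<^sub>L 'e"
  proof -
    have "G (J y) x = - G (J x) y" for x y
      using that sym by metis
    then show ?thesis
      by (rule wedge_2_2[of "kaehler_form G J" "kaehler_form G J", unfolded k, rotated]) fact
  qed
  from this[OF skew1] this[OF skew2] this[OF skew3] show ?thesis
    unfolding four_form_def by simp
qed

section \<open>Differentiating a local frame and its four-form at a point\<close>

locale frame_field =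
  fixes U :: "'e::euclidean_space set" and x :: 'e and G :: "'e \<Rightarrow> 'e bilin"
    and J1 J2 J3 :: "'e \<Rightarrow> 'e \<Rightarrow>\<^sub>L 'e" and G' J1' J2' J3'
  assumes U: "open U" "x \<in> U"
    and frame: "\<And>y. y \<in> U \<Longrightarrow> quaternionic_frame (G y) (J1 y) (J2 y) (J3 y)"
    and G': "(G has_derivative G') (at x)"
    and J': "(J1 has_derivative J1') (at x)" "(J2 has_derivative J2') (at x)" "(J3 has_derivative J3') (at x)"
    and levi_civita: "is_levi_civita G x (levi_civita G x)"
begin

sublocale quaternionic_frame "G x" "J1 x" "J2 x" "J3 x"
  using frame U by blast

abbreviation A1 :: "'e \<Rightarrow> 'e \<Rightarrow>\<^sub>L 'e" where "A1 u \<equiv> cov_deriv_endo G J1 x u"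
abbreviation A2 :: "'e \<Rightarrow> 'e \<Rightarrow>\<^sub>L 'e" where "A2 u \<equiv> cov_deriv_endo G J2 x u"
abbreviation A3 :: "'e \<Rightarrow> 'e \<Rightarrow>\<^sub>L 'e" where "A3 u \<equiv> cov_deriv_endo G J3 x u"

text \<open>Differentiate the skewness of \<open>B\<close>, valid near \<open>x\<close>; the
  connection terms cancel by skewness at \<open>x\<close> itself. The next lemmas likewise
  differentiate \<open>J\<^sub>i\<^sup>2 = -1\<close> and
  \<open>J\<^sub>1 J\<^sub>2 = J\<^sub>3\<close>.\<close>

lemma cov_deriv_skew_aux:
  fixes B :: "'e \<Rightarrow> 'e \<Rightarrow>\<^sub>L 'e"
  assumes B': "(B has_derivative B') (at x)"
    and skew: "\<And>y v w. y \<in> U \<Longrightarrow> G y v (B y w) = - G y (B y v) w"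
  shows "G x v (cov_deriv_endo G B x u w) = - G x (cov_deriv_endo G B x u v) w"
proof -
  note D = has_derivative_bilin_endo[OF G' levi_civita B']
  have s: "G y (B y w) v = - G y (B y v) w" if "y \<in> U" for y v w
    using skew[OF that] quaternionic_frame.sym[OF frame[OF that]] by metis
  have "((\<lambda>y. - G y (B y v) w) has_derivative (\<lambda>u. G x (cov_deriv_endo G B x u w) v +
    G x (B x (levi_civita G x u w)) v + G x (B x w) (levi_civita G x u v))) (at x)"
    by (rule has_derivative_transform_within_open[OF D U]) (rule s)
  from fun_cong[OF has_derivative_unique[OF this has_derivative_minus[OF D]], of u]
  show ?thesis
    using s[OF U(2), of w "levi_civita G x u v"] s[OF U(2), of v "levi_civita G x u w"] sym by simp
qed

lemma cov_deriv_skew: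
  "G x v (A1 u w) = - G x (A1 u v) w" "G x v (A2 u w) = - G x (A2 u v) w" "G x v (A3 u w) = - G x (A3 u v) w"
  using cov_deriv_skew_aux[OF J'(1)] cov_deriv_skew_aux[OF J'(2)] cov_deriv_skew_aux[OF J'(3)]
    quaternionic_frame.skews[OF frame] by blast+

lemma cov_deriv_anti_aux:
  fixes B :: "'e \<Rightarrow> 'e \<Rightarrow>\<^sub>L 'e"
  assumes B': "(B has_derivative B') (at x)" and B: "\<And>y w. y \<in> U \<Longrightarrow> B y (B y w) = - w"
  shows "cov_deriv_endo G B x u (B x w) = - B x (cov_deriv_endo G B x u w)"
proof -
  have "cov_deriv_endo G (\<lambda>y. - id_blinfun) x u = cov_deriv_endo G (\<lambda>y. B y o\<^sub>L B y) x u"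
    by (subst cov_deriv_endo_cong[OF has_derivative_const U, where C="\<lambda>y. B y o\<^sub>L B y"])
      (auto intro!: blinfun_eqI simp: B blinfun.bilinear_simps)
  then have "(cov_deriv_endo G B x u o\<^sub>L B x) w + (B x o\<^sub>L cov_deriv_endo G B x u) w = 0"
    unfolding cov_deriv_endo_minus_id cov_deriv_endo_compose[OF B' B'] by (metis blinfun.add_left zero_blinfun.rep_eq)
  then show ?thesis by (simp add: eq_neg_iff_add_eq_0)
qed

lemma cov_deriv_anti:
  "A1 u (J1 x w) = - J1 x (A1 u w)" "A2 u (J2 x w) = - J2 x (A2 u w)" "A3 u (J3 x w) = - J3 x (A3 u w)"
  using cov_deriv_anti_aux[OF J'(1)] cov_deriv_anti_aux[OF J'(2)] cov_deriv_anti_aux[OF J'(3)]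
    quaternionic_frame.mult_table(1-3)[OF frame] by blast+

lemma cov_deriv_leibniz: "A3 u w = A1 u (J2 x w) + J1 x (A2 u w)"
proof -
  have "A3 u = cov_deriv_endo G (\<lambda>y. J1 y o\<^sub>L J2 y) x u"
    by (subst cov_deriv_endo_cong[OF J'(3) U, where C="\<lambda>y. J1 y o\<^sub>L J2 y"])
      (auto intro!: blinfun_eqI simp: quaternionic_frame.mult_table[OF frame])
  then show ?thesis
    unfolding cov_deriv_endo_compose[OF J'(1,2)] by (simp add: blinfun.bilinear_simps)
qed

text \<open>The connection terms from the product rule are exactly those subtracted in
  \<open>cov_deriv_form\<close>.\<close>

lemma cov_deriv_four_form:
  assumes \<psi>: "\<And>y. y \<in> U \<Longrightarrow> \<psi> y = four_form (G y) (J1 y) (J2 y) (J3 y)"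
  shows "cov_deriv_form G \<psi> x u [X, Y, Z, W] =
    2 * four_form_variation (G x) (J1 x) (J2 x) (J3 x) (A1 u) (A2 u) (A3 u) X Y Z W"
proof -
  let ?F = "\<lambda>X Y Z W y. wedge22 (\<lambda>v w. G y (J1 y v) w) (\<lambda>v w. G y (J1 y v) w) X Y Z W +
     wedge22 (\<lambda>v w. G y (J2 y v) w) (\<lambda>v w. G y (J2 y v) w) X Y Z W +
     wedge22 (\<lambda>v w. G y (J3 y v) w) (\<lambda>v w. G y (J3 y v) w) X Y Z W"
  have F: "\<psi> y [X, Y, Z, W] = ?F X Y Z W y" if "y \<in> U" for y X Y Z W
    unfolding \<psi>[OF that] by (rule quaternionic_frame.four_form_eq_wedge22[OF frame[OF that]])
  have D: "((\<lambda>y. wedge22 (\<lambda>v w. G y (B y v) w) (\<lambda>v w. G y (B y v) w) X Y Z W) has_derivative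
    (\<lambda>u. 2 * wedge22 (\<lambda>v w. G x (cov_deriv_endo G B x u v) w) (\<lambda>v w. G x (B x v) w) X Y Z W +
      wedge22 (\<lambda>v w. G x (B x v) w) (\<lambda>v w. G x (B x v) w) (levi_civita G x u X) Y Z W +
      wedge22 (\<lambda>v w. G x (B x v) w) (\<lambda>v w. G x (B x v) w) X (levi_civita G x u Y) Z W +
      wedge22 (\<lambda>v w. G x (B x v) w) (\<lambda>v w. G x (B x v) w) X Y (levi_civita G x u Z) W +
      wedge22 (\<lambda>v w. G x (B x v) w) (\<lambda>v w. G x (B x v) w) X Y Z (levi_civita G x u W))) (at x)"
    if "(B has_derivative B') (at x)" for B B' :: "'e \<Rightarrow> 'e \<Rightarrow>\<^sub>L 'e" and X Y Z W
    unfolding wedge22_def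
    by (rule derivative_eq_intros has_derivative_bilin_endo[OF G' levi_civita that] refl)+
      (simp add: algebra_simps fun_eq_iff)
  note D' = has_derivative_add[OF has_derivative_add[OF D[OF J'(1)] D[OF J'(2)]] D[OF J'(3)]]
  have "frechet_derivative (\<lambda>y. \<psi> y [X, Y, Z, W]) (at x) = frechet_derivative (?F X Y Z W) (at x)"
    unfolding frechet_derivative_at[OF D', symmetric]
    by (rule frechet_derivative_at[symmetric], rule has_derivative_transform_within_open[OF D' U])
      (rule F[symmetric])
  then show ?thesis
    unfolding cov_deriv_form_def frechet_derivative_at[OF D', symmetric]
    by (simp add: eval_nat_numeral lessThan_Suc F[OF U(2)] four_form_variation_def)
qed

text \<open>The first two summands cancel, since removing either \<open>u\<close> leaves the same
  list. The others differentiate functions vanishing near \<open>x\<close>. Thus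
  \<open>d\<Omega>\<close> drops out of the conformal-Killing equation at
  \<open>(u, Y, Z, W)\<close>.\<close>

lemma ext_deriv_four_form:
  assumes \<psi>: "\<And>y. y \<in> U \<Longrightarrow> \<psi> y = four_form (G y) (J1 y) (J2 y) (J3 y)"
  shows "ext_deriv \<psi> x [u, u, Y, Z, W] = 0"
proof -
  have *: "frechet_derivative (\<lambda>y. \<psi> y [u, u, Z, W]) (at x) = (\<lambda>_. 0)" for Z W
  proof -
    have "\<psi> y [u, u, Z, W] = 0" if "y \<in> U" for y
      unfolding \<psi>[OF that] quaternionic_frame.four_form_eq_wedge22[OF frame[OF that]] wedge22_def
      by (simp add: quaternionic_frame.self_orthogonal[OF frame[OF that]])
    then show ?thesis
      using frechet_derivative_at[OF has_derivative_transform_within_open[OF has_derivative_const U, where g="\<lambda>y. \<psi> y [u, u, Z, W]"]]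
      by simp
  qed
  show ?thesis
    unfolding ext_deriv_def by (simp add: eval_nat_numeral lessThan_Suc *)
qed

lemma cov_deriv_in_span:
  assumes \<psi>: "\<And>y. y \<in> U \<Longrightarrow> \<psi> y = four_form (G y) (J1 y) (J2 y) (J3 y)"
    and ck: "\<And>u vs. length vs = 4 \<Longrightarrow> cov_deriv_form G \<psi> x u vs =
        k * interior_prod u (ext_deriv \<psi> x) vs - l * wedge 1 3 (flat (G x) u) (codiff G \<psi> x) vs"
  shows "A1 u \<in> span {J1 x, J2 x, J3 x}" "A2 u \<in> span {J1 x, J2 x, J3 x}" "A3 u \<in> span {J1 x, J2 x, J3 x}"
proof -
  \<comment> \<open>The 12 combines the 6 of \<open>wedge_flat_3\<close> with the 2 of
    \<open>cov_deriv_four_form\<close>. The factor after \<open>G x u u\<close> is independent of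
    \<open>u\<close>, which gives the hypothesis \<open>conformal\<close>.\<close>
  have *: "four_form_variation (G x) (J1 x) (J2 x) (J3 x) (A1 u) (A2 u) (A3 u) u Y Z W =
     G x u u * (- l / 12 * (codiff G \<psi> x [Y, Z, W] - codiff G \<psi> x [Y, W, Z] - codiff G \<psi> x [Z, Y, W]
     + codiff G \<psi> x [Z, W, Y] + codiff G \<psi> x [W, Y, Z] - codiff G \<psi> x [W, Z, Y]))"
    if "G x u Y = 0" "G x u Z = 0" "G x u W = 0" for u Y Z W
  proof -
    have "ext_deriv \<psi> x [u, u, Y, Z, W] = 0"
      by (rule ext_deriv_four_form) (rule \<psi>)
    moreover have "cov_deriv_form G \<psi> x u [u, Y, Z, W] =
        2 * four_form_variation (G x) (J1 x) (J2 x) (J3 x) (A1 u) (A2 u) (A3 u) u Y Z W"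
      by (rule cov_deriv_four_form) (rule \<psi>)
    ultimately show ?thesis
      using ck[of "[u, Y, Z, W]" u] unfolding interior_prod_def wedge_flat_3[of "G x" u, OF that]
      by (simp add: field_simps)
  qed
  have "A1 u \<in> span {J1 x, J2 x, J3 x} \<and> A2 u \<in> span {J1 x, J2 x, J3 x} \<and> A3 u \<in> span {J1 x, J2 x, J3 x}"
  proof (cases "u = 0")
    case True
    then show ?thesis
      unfolding cov_deriv_endo_eq[OF J'(1)] cov_deriv_endo_eq[OF J'(2)] cov_deriv_endo_eq[OF J'(3)]
      using J'[THEN has_derivative_bounded_linear, THEN linear_simps(3)]
      by (simp add: blinfun.bilinear_simps span_zero)
  next
    case False
    show ?thesis
      by (intro conjI span_if_conformal[of A1 A2 A3 u] cov_deriv_skew cov_deriv_anti cov_deriv_leibniz False)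
        (simp_all add: *)
  qed
  then show "A1 u \<in> span {J1 x, J2 x, J3 x}" "A2 u \<in> span {J1 x, J2 x, J3 x}" "A3 u \<in> span {J1 x, J2 x, J3 x}"
    by blast+
qed

lemma cov_deriv_section_in_span:
  assumes A': "(A has_derivative A') (at x)" and A: "\<And>y. y \<in> U \<Longrightarrow> A y \<in> span {J1 y, J2 y, J3 y}"
    and J: "A1 u \<in> span {J1 x, J2 x, J3 x}" "A2 u \<in> span {J1 x, J2 x, J3 x}" "A3 u \<in> span {J1 x, J2 x, J3 x}"
  shows "cov_deriv_endo G A x u \<in> span {J1 x, J2 x, J3 x}"
proof -
  obtain e :: 'e where e: "e \<noteq> 0" using nonempty_Basis nonzero_Basis by blast
  \<comment> \<open>The coefficients of \<open>A\<close> are differentiable, as \<open>J\<^sub>1 e, J\<^sub>2 e, J\<^sub>3 e\<close> are orthogonal with common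
    length that of \<open>e\<close>.\<close>
  define f where "f B y = G y (A y e) (B y e) / G y e e" for B :: "'e \<Rightarrow> 'e \<Rightarrow>\<^sub>L 'e" and y
  have A_eq: "A y = f J1 y *\<^sub>R J1 y + f J2 y *\<^sub>R J2 y + f J3 y *\<^sub>R J3 y" if y: "y \<in> U" for y
  proof -
    interpret y: quaternionic_frame "G y" "J1 y" "J2 y" "J3 y" using frame y .
    obtain a b c where abc: "A y = a *\<^sub>R J1 y + b *\<^sub>R J2 y + c *\<^sub>R J3 y"
      using span3D[OF A[OF y]] by blast
    have "f J1 y = a" "f J2 y = b" "f J3 y = c"
      unfolding f_def abc using y.pos[OF e]
      by (simp_all add: blinfun.bilinear_simps y.skews y.mult_table y.self_orthogonal)
    then show ?thesis using abc by simp
  qed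
  have "\<exists>f'. (f B has_derivative f') (at x)" if "(B has_derivative B') (at x)" for B B'
    unfolding f_def using pos[OF e]
    by (auto intro!: exI derivative_eq_intros G' A' that)
  then obtain f1 f2 f3 where f: "(f J1 has_derivative f1) (at x)" "(f J2 has_derivative f2) (at x)"
    "(f J3 has_derivative f3) (at x)"
    using J' by metis
  have "cov_deriv_endo G A x u =
      cov_deriv_endo G (\<lambda>y. f J1 y *\<^sub>R J1 y + f J2 y *\<^sub>R J2 y + f J3 y *\<^sub>R J3 y) x u"
    using cov_deriv_endo_cong[OF A' U A_eq] by simp
  also have "\<dots> = f1 u *\<^sub>R J1 x + f J1 x *\<^sub>R A1 u + (f2 u *\<^sub>R J2 x + f J2 x *\<^sub>R A2 u)
      + (f3 u *\<^sub>R J3 x + f J3 x *\<^sub>R A3 u)"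
    using f[THEN has_derivative_scaleR, OF J'(1)] f[THEN has_derivative_scaleR, OF J'(2)]
    by (simp add: cov_deriv_endo_add[OF has_derivative_add[OF has_derivative_scaleR[OF f(1) J'(1)]
        has_derivative_scaleR[OF f(2) J'(2)]] has_derivative_scaleR[OF f(3) J'(3)]]
       cov_deriv_endo_add[OF has_derivative_scaleR[OF f(1) J'(1)] has_derivative_scaleR[OF f(2) J'(2)]]
       cov_deriv_endo_scaleR[OF f(1) J'(1)] cov_deriv_endo_scaleR[OF f(2) J'(2)] cov_deriv_endo_scaleR[OF f(3) J'(3)])
  finally show ?thesis
    using J by (auto intro!: span_add span_scale intro: span_base)
qed

end

section \<open>From the manifold to a local admissible frame\<close>

lemma smooth_on_has_derivative:
  assumes "smooth_on U f" "x \<in> U"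
  obtains f' where "(f has_derivative f') (at x)"
proof -
  have "Ck_on (Suc 0) U f" using assms(1) unfolding smooth_on_def by blast
  then have "f differentiable (at x)" using assms(2) by simp
  then show ?thesis using that unfolding differentiable_def by blast
qed

lemma quaternionic_frame_if_admissible_basis:
  fixes G :: "'e::euclidean_space bilin"
  assumes J: "admissible_basis E J1 J2 J3"
    and sym: "\<And>u v. G u v = G v u" and pos: "\<And>u. u \<noteq> 0 \<Longrightarrow> G u u > 0"
    and hermitian: "\<And>J u v. J \<in> E \<Longrightarrow> J o\<^sub>L J = - id_blinfun \<Longrightarrow> G (blinfun_apply J u) (blinfun_apply J v) = G u v"
  shows "quaternionic_frame G J1 J2 J3"
proof -
  have sq: "J1 o\<^sub>L J1 = - id_blinfun" "J2 o\<^sub>L J2 = - id_blinfun" "J3 o\<^sub>L J3 = - id_blinfun"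
    and "J1 o\<^sub>L J2 = - (J2 o\<^sub>L J1)" "J1 o\<^sub>L J3 = - (J3 o\<^sub>L J1)" "J2 o\<^sub>L J3 = - (J3 o\<^sub>L J2)"
    and "J1 o\<^sub>L J2 = J3"
    and E: "E = span {J1, J2, J3}"
    using J unfolding admissible_basis_def by auto
  then have app: "J1 (J1 w) = - w" "J2 (J2 w) = - w" "J3 (J3 w) = - w"
    "J1 (J2 w) = - J2 (J1 w)" "J1 (J3 w) = - J3 (J1 w)" "J2 (J3 w) = - J3 (J2 w)"
    "J1 (J2 w) = J3 w" for w
    by (metis blinfun_apply_blinfun_compose blinfun_apply_id_blinfun uminus_blinfun.rep_eq)+
  have table: "J1 (J3 w) = - J2 w" "J3 (J2 w) = - J1 w" for w
    using app(1)[of "J2 w"] app(7)[of "J2 w"] by (simp_all add: app blinfun.bilinear_simps flip: app(7))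
  have table': "J2 (J3 w) = J1 w" "J3 (J1 w) = J2 w" "J2 (J1 w) = - J3 w" for w
    using app(4-7)[of w] table[of w] by simp_all
  have "J1 \<in> E" "J2 \<in> E" "J3 \<in> E"
    unfolding E by (auto intro: span_base)
  then have inv: "G (J1 u) (J1 v) = G u v" "G (J2 u) (J2 v) = G u v" "G (J3 u) (J3 v) = G u v" for u v
    using hermitian sq by blast+
  \<comment> \<open>An isometry with square \<open>-1\<close> is skew.\<close>
  have skew: "G u (J1 v) = - G (J1 u) v" "G u (J2 v) = - G (J2 u) v" "G u (J3 v) = - G (J3 u) v" for u v
    using inv[of u "J1 v"] inv[of u "J2 v"] inv[of u "J3 v"] by (simp_all add: app(1-3) blinfun.bilinear_simps)
  show ?thesis
    by unfold_locales (fact sym skew app table table' | erule pos)+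
qed

theorem theorem1:
  fixes M :: "'p topology"
    and \<A> :: "('p, 'e::euclidean_space) chart set"
    and Q :: "('p, 'e) chart \<Rightarrow> 'e \<Rightarrow> ('e \<Rightarrow>\<^sub>L 'e) set"
    and g :: "('p, 'e) chart \<Rightarrow> 'e \<Rightarrow> 'e bilin"
    and n :: nat
  assumes "smooth_manifold M \<A>"
    and "DIM('e) = 4 * n" and "4 * n \<ge> 8"
    and "almost_quaternionic_hermitian \<A> Q g"
    and "conformal_killing \<A> g 4 (fundamental_form Q g)"
  shows "quaternionic_kaehler \<A> Q g"
  unfolding quaternionic_kaehler_def
proof (intro conjI ballI allI impI)
  show "almost_quaternionic_hermitian \<A> Q g" by fact
  show "DIM('e) \<ge> 8" using assms by simp
  fix c W A x u
  assume c: "c \<in> \<A>" and "open W \<and> W \<subseteq> chart_image c \<and> smooth_on W A \<and> (\<forall>y\<in>W. A y \<in> Q c y)"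
    and x: "x \<in> W"
  then have W: "open W" "W \<subseteq> chart_image c" and A: "smooth_on W A" "\<And>y. y \<in> W \<Longrightarrow> A y \<in> Q c y"
    by auto
  have img: "open (chart_image c)" "x \<in> chart_image c"
    using assms(1) c W x unfolding smooth_manifold_def by auto
  have aq: "almost_quaternionic \<A> Q" and riem: "riemannian_metric \<A> g"
    and hermitian: "\<And>y J u v. y \<in> chart_image c \<Longrightarrow> J \<in> Q c y \<Longrightarrow> J o\<^sub>L J = - id_blinfun \<Longrightarrow>
      g c y (J u) (J v) = g c y u v"
    using assms(4) c unfolding almost_quaternionic_hermitian_def by auto
  obtain V J1 J2 J3 where V: "open V" "x \<in> V" "V \<subseteq> chart_image c"
    and J: "smooth_on V J1" "smooth_on V J2" "smooth_on V J3"
    and adm: "\<And>y. y \<in> V \<Longrightarrow> admissible_basis (Q c y) (J1 y) (J2 y) (J3 y)"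
    using aq c img(2) unfolding almost_quaternionic_def by meson
  have g: "smooth_on (chart_image c) (g c)"
    "\<And>y u v. y \<in> chart_image c \<Longrightarrow> g c y u v = g c y v u"
    "\<And>y u. y \<in> chart_image c \<Longrightarrow> u \<noteq> 0 \<Longrightarrow> g c y u u > 0"
    using riem c unfolding riemannian_metric_def by blast+
  have span: "Q c y = span {J1 y, J2 y, J3 y}" if "y \<in> V" for y
    using adm[OF that] unfolding admissible_basis_def by blast
  obtain J1' J2' J3' g' A' where J': "(J1 has_derivative J1') (at x)" "(J2 has_derivative J2') (at x)"
      "(J3 has_derivative J3') (at x)"
    and g': "(g c has_derivative g') (at x)" and A': "(A has_derivative A') (at x)"
    using smooth_on_has_derivative J V(2) g(1) img(2) A(1) x by metis
  interpret frame_field "V \<inter> W" x "g c" J1 J2 J3 g' J1' J2' J3'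
  proof (rule frame_field.intro)
    show "open (V \<inter> W)" "x \<in> V \<inter> W" using V W x by auto
    show "quaternionic_frame (g c y) (J1 y) (J2 y) (J3 y)" if "y \<in> V \<inter> W" for y
      using that V(3) by (intro quaternionic_frame_if_admissible_basis[OF adm]) (auto intro: g hermitian)
    show "is_levi_civita (g c) x (levi_civita (g c) x)"
      by (rule is_levi_civita_levi_civita[OF riem c img])
  qed fact+
  have \<psi>: "fundamental_form Q g c y = four_form (g c y) (J1 y) (J2 y) (J3 y)" if "y \<in> V \<inter> W" for y
    by (rule fundamental_form_eq) (use adm that in blast)
  \<comment> \<open>The constants \<open>k\<close> and \<open>l\<close> of
    \<open>cov_deriv_in_span\<close> become \<open>1/5\<close> and
    \<open>1/(4n - 3)\<close>.\<close>
  have "length vs = 4 \<Longrightarrow> cov_deriv_form (g c) (fundamental_form Q g c) x u vs =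
      1 / (real 4 + 1) * interior_prod u (ext_deriv (fundamental_form Q g c) x) vs -
      1 / (real DIM('e) - real 4 + 1) * wedge 1 3 (flat (g c x) u) (codiff (g c) (fundamental_form Q g c) x) vs" for u vs
    using assms(5) c img(2) unfolding conformal_killing_def by simp
  note cov = cov_deriv_in_span[OF \<psi> this]
  have sec: "A y \<in> span {J1 y, J2 y, J3 y}" if "y \<in> V \<inter> W" for y
    using A(2) span that by blast
  show "cov_deriv_endo (g c) A x u \<in> Q c x"
    unfolding span[OF V(2)]
    by (rule cov_deriv_section_in_span[OF A' sec cov])
qed

end
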